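(* Let $\mathcal L$ be a finite relational language of maximum arity $r\ge2$, let $\mathcal H$ be a non-trivial hereditary $\mathcal L$-property, and let $\mathcal F$ be a class of finite $\mathcal L$-structures, closed under isomorphism, such that $\mathcal H=\mathrm{Forb}(\mathcal F)$. Then for all $\delta>0$ there are $\epsilon>0$ and $K$ such that for all sufficiently large $n$, if $M$ is an $\mathcal L_{\mathcal H}$-template of size $n$ with $\mathrm{prob}(\tilde{\mathcal F}(K)\cup\mathcal E(K),M)<\epsilon$, then 1. if $\pi(\mathcal H)>1$, then $sub(M)\le ex(n,\mathcal H)^{1+\delta}$; 2. if $\pi(\mathcal H)\le1$, then $sub(M)\le2^{\delta\binom nr}$.
   Context: $\mathcal L$ is a finite relational first-order language with maximum arity $r\ge 2$. All formulas and types are quantifier-free. $\binom{V}{r}$ is the set of $r$-element subsets of $V$; $V^{\underline r}$ is the set of $r$-tuples of pairwise distinct elements of $V$; for $\bar a=(a_1,\dots,a_r)$, $\cup\bar a=\{a_1,\dots,a_r\}$ and, for a permutation $\mu$ of $[r]$, $\mu(\bar a)=(a_{\mu(1)},\dots,a_{\mu(r)})$. The size of a structure is the cardinality of its domain. A hereditary $\mathcal L$-property is a nonempty class of finite $\mathcal L$-structures closed under isomorphism and (model-theoretic, i.e. induced) substructures. It is trivial if it has no elements of size $n$ for all sufficiently large $n$, and non-trivial otherwise. $\mathrm{Forb}(\mathcal F)$ is the class of all finite $\mathcal L$-structures having no substructure isomorphic to an element of $\mathcal F$. Types: $S_r(\mathcal H)$ is the set of complete quantifier-free $r$-types $p(x_1,\dots,x_r)$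 in $\mathcal L$ that are proper (contain $x_i\ne x_j$ for $i\neq j$) and are realized in some element of $\mathcal H$. For a set $V$ let $C_V=\{c_v:v\in V\}$ be new constants; for $\bar a\in V^{\underline r}$, $p(c_{\bar a})$ is the set of sentences obtained by substituting $c_{a_i}$ for $x_i$; $S_r(C_V,\mathcal H)=\{p(c_{\bar a}):p\in S_r(\mathcal H),\bar a\in V^{\underline r}\}$. For an $\mathcal L$-structure $N$ and $A\subseteq \mathrm{dom}(N)$, $Diag^N(A)$ is the set of quantifier-free sentences in $\mathcal L\cup C_A$ true in $N$ when $c_a$ names $a$. $\mathcal L_{\mathcal H}=\{R_p:p\in S_r(\mathcal H)\}$ is the language with one $r$-ary relation symbol per element of $S_r(\mathcal H)$. An $\mathcal L_{\mathcal H}$-structure $M$ with domain $V$ is complete if for every $A\in\binom Vr$ there are an enumeration $\bar a$ of $A$ and $R_p\in\mathcal L_{\mathcal H}$ with $M\models R_p(\bar a)$. $M$ is an $\mathcal L_{\mathcal H}$-template if it is complete and (1) $M\models\neg R_p(\bar a)$ for all $p\in S_r(\mathcal H)$, $\bar a\in V^r\setminus V^{\underline r}$; (2) whenever $p,p'\in S_r(\mathcal H)$ and a permutation $\mu$ of $[r]$ satisfy $p(\bar x)=p'(\mu(\bar x))$, then for all $\bar a\in V^{\underline r}$, $M\models R_p(\bar a)$ iff $M\models R_{p'}(\mu(\bar a))$. For $A\in\binom Vr$, $Ch_M(A)=\{p(c_{\bar a})\in S_r(C_V,\mathcal H):\cup\bar a=A,\ M\models R_p(\bar a)\}$. A choice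 function for $M$ is $\chi:\binom Vr\to S_r(C_V,\mathcal H)$ with $\chi(A)\in Ch_M(A)$ for all $A$. For complete $M$, an $\mathcal L$-structure $N$ with domain $V$ is a full subpattern of $M$ chosen by $\chi$, written $N\unlhd_\chi M$, if $Diag^N(A)=\chi(A)$ for all $A\in\binom Vr$; $N\unlhd_p M$ means $N\unlhd_\chi M$ for some choice function $\chi$. $sub(M)=|\{N:N\unlhd_pM\}|$ for finite $M$. $M$ is $\mathcal H$-random if it is complete and for every choice function $\chi$ there is $N\in\mathcal H$ with $N\unlhd_\chi M$. $\mathcal R(n,\mathcal H)$ is the class of all $\mathcal H$-random $\mathcal L_{\mathcal H}$-templates of size $n$. $ex(n,\mathcal H)=\max\{sub(M):M\in\mathcal R(n,\mathcal H)\}$ with $\max\emptyset=0$, and $\pi(\mathcal H)=\lim_{n\to\infty}ex(n,\mathcal H)^{1/\binom nr}$ (this limit exists for every hereditary $\mathcal L$-property). $\tilde{\mathcal F}$ is the class of (complete) $\mathcal L_{\mathcal H}$-structures $B$ such that $F\unlhd_pB$ for some $F\in\mathcal F$. For $r<\ell<2r$, an error of size $\ell$ is a complete $\mathcal L_{\mathcal H}$-structure $B$ of size $\ell$ for which there are $\bar a_1,\bar a_2\in \mathrm{dom}(B)^{\underline r}$ with $\mathrm{dom}(B)=(\cup\bar a_1)\cup(\cup\bar a_2)$ and $p_1,p_2\in S_r(\mathcal H)$ with $B\models R_{p_1}(\bar a_1)\wedge R_{p_2}(\bar a_2)$ but $p_1(c_{\bar a_1})\cup p_2(c_{\bar a_2})$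 unsatisfiable. $\mathcal E$ is the class of all errors (of sizes $r<\ell<2r$). For a class $\mathcal A$ of finite structures, $\mathcal A(K)$ here denotes the class of elements of $\mathcal A$ of size at most $K$. For finite structures $B$ of size $\ell$ and $M$ of size $L$ in the same language, $\mathrm{prob}(B,M)$ is the number of substructures of $M$ isomorphic to $B$ divided by $\binom L\ell$. For a class $\mathcal B$, $\mathrm{prob}(\mathcal B,M)=\max\{\mathrm{prob}(B,M):B\in\mathcal B\}$ (maximum over representatives of isomorphism types; $\max\emptyset=0$). *)

theory Defs
  imports Complex_Main "HOL-Library.Ramsey" "HOL-Combinatorics.Permutations"
begin

record 's lang =
  symbols :: "'s set"
  arity :: "'s \<Rightarrow> nat"

text \<open>As usual, relation symbols have positive arity.\<close>

definition finite_lang :: "'s lang \<Rightarrow> bool" where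
  "finite_lang L \<longleftrightarrow> finite (symbols L) \<and> symbols L \<noteq> {} \<and> (\<forall>R\<in>symbols L. 1 \<le> arity L R)"

definition max_arity :: "'s lang \<Rightarrow> nat" where
  "max_arity L = Max (arity L ` symbols L)"

record ('s, 'v) rel_struct =
  univ :: "'v set"
  interp :: "'s \<Rightarrow> 'v list set"

definition tuples :: "nat \<Rightarrow> 'v set \<Rightarrow> 'v list set" where
  "tuples k V = {a. length a = k \<and> set a \<subseteq> V}"

definition dtuples :: "nat \<Rightarrow> 'v set \<Rightarrow> 'v list set" where
  "dtuples k V = {a \<in> tuples k V. distinct a}"

text \<open>Symbols outside the language are interpreted by the empty relation, so that two
  \<open>L\<close>-structures are equal as records iff they have the same domain and the same relations;
  this matters when structures are counted. Domains are nonempty.\<close>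

definition is_struct :: "'s lang \<Rightarrow> ('s, 'v) rel_struct \<Rightarrow> bool" where
  "is_struct L M \<longleftrightarrow> univ M \<noteq> {} \<and>
     (\<forall>R\<in>symbols L. interp M R \<subseteq> tuples (arity L R) (univ M)) \<and>
     (\<forall>R. R \<notin> symbols L \<longrightarrow> interp M R = {})"

definition is_fin_struct :: "'s lang \<Rightarrow> ('s, 'v) rel_struct \<Rightarrow> bool" where
  "is_fin_struct L M \<longleftrightarrow> is_struct L M \<and> finite (univ M)"

abbreviation size_of :: "('s, 'v) rel_struct \<Rightarrow> nat" where
  "size_of M \<equiv> card (univ M)"

definition substructure :: "('s, 'v) rel_struct \<Rightarrow> ('s, 'v) rel_struct \<Rightarrow> bool" where
  "substructure N M \<longleftrightarrow> univ N \<noteq> {} \<and> univ N \<subseteq> univ M \<and>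
     (\<forall>R. interp N R = interp M R \<inter> lists (univ N))"

definition isomorphic :: "('s, 'v) rel_struct \<Rightarrow> ('s, 'w) rel_struct \<Rightarrow> bool" where
  "isomorphic M N \<longleftrightarrow> (\<exists>f. bij_betw f (univ M) (univ N) \<and>
     (\<forall>R. \<forall>a\<in>lists (univ M). a \<in> interp M R \<longleftrightarrow> map f a \<in> interp N R))"

text \<open>Classes of finite structures are represented by their members whose domain is a subset
  of a fixed infinite type; as the classes are closed under isomorphism, nothing is lost.\<close>

definition iso_closed :: "'s lang \<Rightarrow> ('s, 'v) rel_struct set \<Rightarrow> bool" where
  "iso_closed L C \<longleftrightarrow> (\<forall>M\<in>C. \<forall>N. is_struct L N \<and> isomorphic M N \<longrightarrow> N \<in> C)"

definition hereditary_property :: "'s lang \<Rightarrow> ('s, 'v) rel_struct set \<Rightarrow> bool" where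
  "hereditary_property L H \<longleftrightarrow> H \<noteq> {} \<and> (\<forall>M\<in>H. is_fin_struct L M) \<and> iso_closed L H \<and>
     (\<forall>M\<in>H. \<forall>N. substructure N M \<longrightarrow> N \<in> H)"

definition trivial_property :: "('s, 'v) rel_struct set \<Rightarrow> bool" where
  "trivial_property H \<longleftrightarrow> (\<forall>\<^sub>F n in sequentially. \<not> (\<exists>M\<in>H. size_of M = n))"

definition Forb :: "'s lang \<Rightarrow> ('s, 'v) rel_struct set \<Rightarrow> ('s, 'v) rel_struct set" where
  "Forb L F = {M. is_fin_struct L M \<and> \<not> (\<exists>N. substructure N M \<and> (\<exists>B\<in>F. isomorphic N B))}"

text \<open>In a relational language the terms are variables and constants. The variables
  \<open>x\<^sub>1, \<dots>, x\<^sub>r\<close> are the numbers \<open>0, \<dots>, r - 1\<close>, with \<open>'t = nat\<close>; the constant \<open>c\<^sub>v\<close> is \<open>v\<close>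
  itself, with \<open>'t = 'v\<close>.\<close>

datatype ('s, 't) qf =
    Eq 't 't
  | Rel 's "'t list"
  | Neg "('s, 't) qf"
  | Conj "('s, 't) qf" "('s, 't) qf"

primrec wf_qf :: "'s lang \<Rightarrow> 't set \<Rightarrow> ('s, 't) qf \<Rightarrow> bool" where
  "wf_qf L T (Eq s t) \<longleftrightarrow> s \<in> T \<and> t \<in> T"
| "wf_qf L T (Rel R ts) \<longleftrightarrow> R \<in> symbols L \<and> ts \<in> tuples (arity L R) T"
| "wf_qf L T (Neg \<phi>) \<longleftrightarrow> wf_qf L T \<phi>"
| "wf_qf L T (Conj \<phi> \<psi>) \<longleftrightarrow> wf_qf L T \<phi> \<and> wf_qf L T \<psi>"

primrec sat :: "('s, 'v) rel_struct \<Rightarrow> ('t \<Rightarrow> 'v) \<Rightarrow> ('s, 't) qf \<Rightarrow> bool" where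
  "sat M h (Eq s t) \<longleftrightarrow> h s = h t"
| "sat M h (Rel R ts) \<longleftrightarrow> map h ts \<in> interp M R"
| "sat M h (Neg \<phi>) \<longleftrightarrow> \<not> sat M h \<phi>"
| "sat M h (Conj \<phi> \<psi>) \<longleftrightarrow> sat M h \<phi> \<and> sat M h \<psi>"

text \<open>A satisfiable set of sentences in the constants \<open>c\<^sub>v\<close>, \<open>v :: 'v\<close>, already has a model with
  domain in \<open>'v\<close>: being quantifier-free, it holds in the substructure of the interpreted
  constants.\<close>

definition satisfiable :: "'s lang \<Rightarrow> ('s, 'v) qf set \<Rightarrow> bool" where
  "satisfiable L \<Phi> \<longleftrightarrow> (\<exists>(N :: ('s, 'v) rel_struct) (h :: 'v \<Rightarrow> 'v).
     is_struct L N \<and> range h \<subseteq> univ N \<and> (\<forall>\<phi>\<in>\<Phi>. sat N h \<phi>))"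

definition Diag :: "'s lang \<Rightarrow> ('s, 'v) rel_struct \<Rightarrow> 'v set \<Rightarrow> ('s, 'v) qf set" where
  "Diag L N A = {\<phi>. wf_qf L A \<phi> \<and> sat N (\<lambda>v. v) \<phi>}"

definition complete_type :: "'s lang \<Rightarrow> nat \<Rightarrow> ('s, nat) qf set \<Rightarrow> bool" where
  "complete_type L k p \<longleftrightarrow> (\<forall>\<phi>\<in>p. wf_qf L {..<k} \<phi>) \<and>
     (\<forall>\<phi>. wf_qf L {..<k} \<phi> \<longrightarrow> \<phi> \<in> p \<or> Neg \<phi> \<in> p)"

definition proper_type :: "nat \<Rightarrow> ('s, nat) qf set \<Rightarrow> bool" where
  "proper_type k p \<longleftrightarrow> (\<forall>i<k. \<forall>j<k. i \<noteq> j \<longrightarrow> Neg (Eq i j) \<in> p)"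

definition realized_in :: "nat \<Rightarrow> ('s, nat) qf set \<Rightarrow> ('s, 'v) rel_struct \<Rightarrow> bool" where
  "realized_in k p N \<longleftrightarrow> (\<exists>a\<in>tuples k (univ N). \<forall>\<phi>\<in>p. sat N (\<lambda>i. a ! i) \<phi>)"

definition S_types :: "'s lang \<Rightarrow> ('s, 'v) rel_struct set \<Rightarrow> ('s, nat) qf set set" where
  "S_types L H = {p. complete_type L (max_arity L) p \<and> proper_type (max_arity L) p \<and>
     (\<exists>N\<in>H. realized_in (max_arity L) p N)}"

text \<open>\<open>inst p a\<close> is \<open>p(a)\<close>, where the entries of \<open>a\<close> may be constants or variables.\<close>

definition inst :: "('s, nat) qf set \<Rightarrow> 't list \<Rightarrow> ('s, 't) qf set" where
  "inst p a = map_qf (\<lambda>R. R) (\<lambda>i. a ! i) ` p"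

definition S_types_const ::
    "'s lang \<Rightarrow> ('s, 'v) rel_struct set \<Rightarrow> 'v set \<Rightarrow> ('s, 'v) qf set set" where
  "S_types_const L H V = {inst p a | p a. p \<in> S_types L H \<and> a \<in> dtuples (max_arity L) V}"

text \<open>The relation symbol \<open>R\<^sub>p\<close> is \<open>p\<close> itself.\<close>

type_synonym ('s, 'v) pat = "(('s, nat) qf set, 'v) rel_struct"

definition type_lang :: "'s lang \<Rightarrow> ('s, 'v) rel_struct set \<Rightarrow> ('s, nat) qf set lang" where
  "type_lang L H = \<lparr>symbols = S_types L H, arity = (\<lambda>_. max_arity L)\<rparr>"

definition complete_pat :: "'s lang \<Rightarrow> ('s, 'v) rel_struct set \<Rightarrow> ('s, 'v) pat \<Rightarrow> bool" where
  "complete_pat L H M \<longleftrightarrow> (\<forall>A\<in>nsets (univ M) (max_arity L).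
     \<exists>a\<in>dtuples (max_arity L) (univ M). set a = A \<and> (\<exists>p\<in>S_types L H. a \<in> interp M p))"

text \<open>\<open>permute_list \<mu> (a\<^sub>1, \<dots>, a\<^sub>r) = (a\<^bsub>\<mu>(1)\<^esub>, \<dots>, a\<^bsub>\<mu>(r)\<^esub>)\<close> up to the shift of indices, and
  \<open>[0..<r]\<close> is the tuple of variables.\<close>

definition template :: "'s lang \<Rightarrow> ('s, 'v) rel_struct set \<Rightarrow> ('s, 'v) pat \<Rightarrow> bool" where
  "template L H M \<longleftrightarrow> (let r = max_arity L; V = univ M in
     is_struct (type_lang L H) M \<and> complete_pat L H M \<and>
     (\<forall>p\<in>S_types L H. \<forall>a\<in>tuples r V - dtuples r V. a \<notin> interp M p) \<and>
     (\<forall>p\<in>S_types L H. \<forall>p'\<in>S_types L H. \<forall>\<mu>.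
        \<mu> permutes {..<r} \<and> inst p [0..<r] = inst p' (permute_list \<mu> [0..<r]) \<longrightarrow>
        (\<forall>a\<in>dtuples r V. a \<in> interp M p \<longleftrightarrow> permute_list \<mu> a \<in> interp M p')))"

definition Ch ::
    "'s lang \<Rightarrow> ('s, 'v) rel_struct set \<Rightarrow> ('s, 'v) pat \<Rightarrow> 'v set \<Rightarrow> ('s, 'v) qf set set" where
  "Ch L H M A = {inst p a | p a. p \<in> S_types L H \<and> a \<in> dtuples (max_arity L) (univ M) \<and>
     set a = A \<and> a \<in> interp M p}"

definition choice_function ::
    "'s lang \<Rightarrow> ('s, 'v) rel_struct set \<Rightarrow> ('s, 'v) pat \<Rightarrow> ('v set \<Rightarrow> ('s, 'v) qf set) \<Rightarrow> bool" where
  "choice_function L H M \<chi> \<longleftrightarrow> (\<forall>A\<in>nsets (univ M) (max_arity L).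
     \<chi> A \<in> S_types_const L H (univ M) \<and> \<chi> A \<in> Ch L H M A)"

definition chosen_subpattern ::
    "'s lang \<Rightarrow> ('s, 'v) rel_struct \<Rightarrow> ('v set \<Rightarrow> ('s, 'v) qf set) \<Rightarrow> ('s, 'v) pat \<Rightarrow> bool" where
  "chosen_subpattern L N \<chi> M \<longleftrightarrow> is_struct L N \<and> univ N = univ M \<and>
     (\<forall>A\<in>nsets (univ M) (max_arity L). Diag L N A = \<chi> A)"

definition full_subpattern ::
    "'s lang \<Rightarrow> ('s, 'v) rel_struct set \<Rightarrow> ('s, 'v) rel_struct \<Rightarrow> ('s, 'v) pat \<Rightarrow> bool" where
  "full_subpattern L H N M \<longleftrightarrow> (\<exists>\<chi>. choice_function L H M \<chi> \<and> chosen_subpattern L N \<chi> M)"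

definition sub :: "'s lang \<Rightarrow> ('s, 'v) rel_struct set \<Rightarrow> ('s, 'v) pat \<Rightarrow> nat" where
  "sub L H M = card {N. full_subpattern L H N M}"

definition H_random :: "'s lang \<Rightarrow> ('s, 'v) rel_struct set \<Rightarrow> ('s, 'v) pat \<Rightarrow> bool" where
  "H_random L H M \<longleftrightarrow> complete_pat L H M \<and>
     (\<forall>\<chi>. choice_function L H M \<chi> \<longrightarrow> (\<exists>N\<in>H. chosen_subpattern L N \<chi> M))"

definition random_templates ::
    "'s lang \<Rightarrow> ('s, 'v) rel_struct set \<Rightarrow> nat \<Rightarrow> ('s, 'v) pat set" where
  "random_templates L H n =
     {M. template L H M \<and> H_random L H M \<and> finite (univ M) \<and> size_of M = n}"

definition ex_num :: "'s lang \<Rightarrow> ('s, 'v) rel_struct set \<Rightarrow> nat \<Rightarrow> nat" where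
  "ex_num L H n = (if random_templates L H n = {} then 0
                   else Max (sub L H ` random_templates L H n))"

definition ex_density :: "'s lang \<Rightarrow> ('s, 'v) rel_struct set \<Rightarrow> real" where
  "ex_density L H = lim (\<lambda>n. real (ex_num L H n) powr (1 / real (n choose max_arity L)))"

definition F_tilde ::
    "'s lang \<Rightarrow> ('s, 'v) rel_struct set \<Rightarrow> ('s, 'v) rel_struct set \<Rightarrow> ('s, 'v) pat set" where
  "F_tilde L H F = {B. is_struct (type_lang L H) B \<and> complete_pat L H B \<and>
     (\<exists>A\<in>F. full_subpattern L H A B)}"

definition is_error :: "'s lang \<Rightarrow> ('s, 'v) rel_struct set \<Rightarrow> nat \<Rightarrow> ('s, 'v) pat \<Rightarrow> bool" where
  "is_error L H l B \<longleftrightarrow> is_fin_struct (type_lang L H) B \<and> complete_pat L H B \<and> size_of B = l \<and>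
     (\<exists>a1\<in>dtuples (max_arity L) (univ B). \<exists>a2\<in>dtuples (max_arity L) (univ B).
        univ B = set a1 \<union> set a2 \<and>
        (\<exists>p1\<in>S_types L H. \<exists>p2\<in>S_types L H. a1 \<in> interp B p1 \<and> a2 \<in> interp B p2 \<and>
           \<not> satisfiable L (inst p1 a1 \<union> inst p2 a2)))"

definition errors :: "'s lang \<Rightarrow> ('s, 'v) rel_struct set \<Rightarrow> ('s, 'v) pat set" where
  "errors L H = {B. \<exists>l. max_arity L < l \<and> l < 2 * max_arity L \<and> is_error L H l B}"

definition up_to_size :: "('s, 'v) rel_struct set \<Rightarrow> nat \<Rightarrow> ('s, 'v) rel_struct set" where
  "up_to_size C K = {B \<in> C. size_of B \<le> K}"

definition prob :: "('s, 'v) rel_struct \<Rightarrow> ('s, 'v) rel_struct \<Rightarrow> real" where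
  "prob B M = real (card {N. substructure N M \<and> isomorphic N B}) /
     real (size_of M choose size_of B)"

text \<open>If \<open>B\<close> is larger than \<open>M\<close> then \<open>prob B M = 0 / 0 = 0\<close>. Since \<open>prob B M\<close> depends on \<open>B\<close>
  only up to isomorphism, representatives need not be chosen, and only finitely many values
  occur when \<open>M\<close> is finite.\<close>

definition prob_class :: "('s, 'v) rel_struct set \<Rightarrow> ('s, 'v) rel_struct \<Rightarrow> real" where
  "prob_class C M = (if C = {} then 0 else Max ((\<lambda>B. prob B M) ` C))"

end

theory Submission
  imports Defs
begin

text \<open>
  The proof is an averaging argument in the style of Erdos and Simonovits. Write \<open>Ch A\<close> for the
  set of choices of a template \<open>M\<close> at an \<open>r\<close>-set \<open>A\<close>, and \<open>log_choices M\<close> for the sum of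
  \<open>ln (card (Ch A))\<close> over all \<open>r\<close>-sets \<open>A\<close>. A full subpattern is determined by its choice
  function, as relations have arity at most \<open>r\<close>; hence, on at least \<open>r\<close> vertices, \<open>sub L H M\<close> is
  at most \<open>exp (log_choices M)\<close>, with equality if \<open>M\<close> is \<open>H\<close>-random
  (\<open>sub_le_exp_log_choices\<close>, \<open>exp_log_choices_le_sub\<close>).

  Being a sum over \<open>r\<close>-sets, \<open>log_choices M\<close> divided by the number of \<open>r\<close>-sets is the average of
  the same density over all induced templates on \<open>K\<close> vertices. Two consequences are drawn
  (\<open>log_choices_averaging\<close>).

  For \<open>H\<close>-random \<open>M\<close> all induced templates are \<open>H\<close>-random too. So the \<open>n\<close>-th term
  \<open>ex_num L H n powr (1 / (n choose r))\<close> decreases for \<open>n \<ge> r\<close>, it converges to \<open>ex_density L H\<close>, and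
  every such term is at least the limit (\<open>ex_num_powr_antimono\<close>, \<open>ex_density_powr_le_ex_num\<close>).

  For an arbitrary template \<open>M\<close>, a \<open>K\<close>-set of vertices none of whose subsets induces an error or a
  member of \<open>F_tilde L H F\<close> induces an \<open>H\<close>-random template (\<open>H_random_if_no_obstruction\<close>): without
  errors, the types picked by a choice function glue to a structure, and this structure has no
  substructure in \<open>F\<close>. If \<open>\<epsilon>\<close> is small in terms of \<open>K\<close>, the hypothesis on \<open>prob_class\<close> makes all
  but a small fraction of the \<open>K\<close>-sets of this kind, because only boundedly many isomorphism types
  of patterns exist on at most \<open>K\<close> vertices (\<open>card_sets_containing_class\<close>). On the good sets the
  density is at most \<open>ln (ex_num L H K)\<close> divided by \<open>K choose r\<close>, which for large \<open>K\<close> exceeds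
  \<open>ln (ex_density L H)\<close> by little or, if \<open>ex_density L H = 0\<close>, is below any given bound; on the
  few bad sets it is bounded by a constant. Averaging bounds \<open>log_choices M\<close> and so \<open>sub L H M\<close>
  (\<open>sub_le_if_few_obstructions\<close>). When \<open>ex_density L H\<close> exceeds \<open>1\<close>, the lower bound for
  \<open>ex_num L H n\<close> turns this into the first claim.
\<close>

section \<open>Counting sets inside larger sets\<close>

lemma card_nsets: "finite V \<Longrightarrow> card (nsets V k) = card V choose k"
proof -
  assume V: "finite V"
  have "nsets V k = {A. A \<subseteq> V \<and> card A = k}"
    using V by (auto simp: nsets_def intro: finite_subset)
  then show ?thesis
    using n_subsets[OF V] by simp
qed

lemma card_nsets_above:
  assumes "finite V" "A \<subseteq> V"
  shows "card {X \<in> nsets V k. A \<subseteq> X} = (if card A \<le> k then (card V - card A) choose (k - card A) else 0)"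
proof (cases "card A \<le> k")
  case True
  have fA: "finite A" using assms finite_subset by blast
  have "bij_betw (\<lambda>X. X - A) {X \<in> nsets V k. A \<subseteq> X} (nsets (V - A) (k - card A))"
  proof (rule bij_betwI[where g = "\<lambda>Z. Z \<union> A"])
    show "(\<lambda>X. X - A) \<in> {X \<in> nsets V k. A \<subseteq> X} \<rightarrow> nsets (V - A) (k - card A)"
      using fA by (auto simp: nsets_def card_Diff_subset)
    show "(\<lambda>Z. Z \<union> A) \<in> nsets (V - A) (k - card A) \<rightarrow> {X \<in> nsets V k. A \<subseteq> X}"
    proof
      fix Z assume Z: "Z \<in> nsets (V - A) (k - card A)"
      then have "card (Z \<union> A) = (k - card A) + card A"
        using fA by (subst card_Un_disjoint) (auto simp: nsets_def)
      then show "Z \<union> A \<in> {X \<in> nsets V k. A \<subseteq> X}"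
        using Z fA assms True by (auto simp: nsets_def)
    qed
  qed (auto simp: nsets_def)
  then have "card {X \<in> nsets V k. A \<subseteq> X} = card (nsets (V - A) (k - card A))"
    by (rule bij_betw_same_card)
  then show ?thesis
    using True assms fA by (simp add: card_nsets card_Diff_subset)
next
  case False
  then have "{X \<in> nsets V k. A \<subseteq> X} = {}"
    by (auto simp: nsets_def dest: card_mono)
  then show ?thesis using False by (metis card.empty)
qed

lemma sum_nsets_nsets:
  fixes f :: "'a set \<Rightarrow> real"
  assumes "finite V" "r \<le> K"
  shows "(\<Sum>X\<in>nsets V K. \<Sum>A\<in>nsets X r. f A)
    = real ((card V - r) choose (K - r)) * (\<Sum>A\<in>nsets V r. f A)"
proof -
  have fin: "finite (nsets V k)" for k
    using assms(1) by (rule finite_imp_finite_nsets)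
  have "(\<Sum>X\<in>nsets V K. \<Sum>A\<in>nsets X r. f A)
      = (\<Sum>X\<in>nsets V K. \<Sum>A | A \<in> nsets V r \<and> A \<subseteq> X. f A)"
    by (intro sum.cong refl) (auto simp: nsets_def)
  also have "\<dots> = (\<Sum>A\<in>nsets V r. \<Sum>X | X \<in> nsets V K \<and> A \<subseteq> X. f A)"
    using sum.swap_restrict[OF fin fin] .
  also have "\<dots> = (\<Sum>A\<in>nsets V r. real ((card V - r) choose (K - r)) * f A)"
  proof (rule sum.cong[OF refl])
    fix A assume "A \<in> nsets V r"
    then have "A \<subseteq> V" "card A = r" by (auto simp: nsets_def)
    then show "(\<Sum>X | X \<in> nsets V K \<and> A \<subseteq> X. f A) = real ((card V - r) choose (K - r)) * f A"
      using card_nsets_above[OF assms(1), of A K] assms(2) by simp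
  qed
  finally show ?thesis by (simp add: sum_distrib_left)
qed

lemma nset_extends:
  assumes "B \<subseteq> V" "finite V" "card B \<le> k" "k \<le> card V"
  obtains A where "B \<subseteq> A" "A \<in> nsets V k"
  using exists_subset_between[OF assms(3,4,1,2)] assms(2)
  unfolding nsets_def by (auto intro: finite_subset)

section \<open>Induced substructures and rare patterns\<close>

definition induced :: "('s, 'v) rel_struct \<Rightarrow> 'v set \<Rightarrow> ('s, 'v) rel_struct" where
  "induced M X = \<lparr>univ = X, interp = (\<lambda>R. interp M R \<inter> lists X)\<rparr>"

lemma induced_simps [simp]:
  "univ (induced M X) = X" "interp (induced M X) R = interp M R \<inter> lists X"
  by (simp_all add: induced_def)

lemma substructure_iff_induced:
  "substructure N M \<longleftrightarrow> (\<exists>X. X \<noteq> {} \<and> X \<subseteq> univ M \<and> N = induced M X)"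
proof
  assume "substructure N M"
  then have "univ N \<noteq> {} \<and> univ N \<subseteq> univ M \<and> N = induced M (univ N)"
    by (auto simp: substructure_def intro!: rel_struct.equality)
  then show "\<exists>X. X \<noteq> {} \<and> X \<subseteq> univ M \<and> N = induced M X" by blast
qed (auto simp: substructure_def)

lemma induced_induced: "Y \<subseteq> X \<Longrightarrow> induced (induced M X) Y = induced M Y"
  by (auto simp: induced_def lists_eq_set)

lemma is_struct_induced:
  "is_struct L M \<Longrightarrow> X \<noteq> {} \<Longrightarrow> is_struct L (induced M X)"
  unfolding is_struct_def tuples_def by (auto simp: lists_eq_set)

lemma is_structD:
  assumes "is_struct L M" "a \<in> interp M R"
  shows "R \<in> symbols L" "length a = arity L R" "set a \<subseteq> univ M"
  using assms unfolding is_struct_def tuples_def by (metis empty_iff, blast+)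

lemma isomorphic_sym:
  assumes "isomorphic M N"
  shows "isomorphic N M"
proof -
  obtain f where f: "bij_betw f (univ M) (univ N)"
    and rel: "\<forall>R. \<forall>a\<in>lists (univ M). a \<in> interp M R \<longleftrightarrow> map f a \<in> interp N R"
    using assms unfolding isomorphic_def by blast
  let ?g = "inv_into (univ M) f"
  have g: "bij_betw ?g (univ N) (univ M)"
    using f by (rule bij_betw_inv_into)
  moreover have "b \<in> interp N R \<longleftrightarrow> map ?g b \<in> interp M R" if b: "b \<in> lists (univ N)" for R b
  proof -
    have "map ?g b \<in> lists (univ M)"
      using b g by (auto simp: lists_eq_set bij_betw_def)
    moreover have "map f (map ?g b) = b"
      using b f by (auto simp: lists_eq_set bij_betw_def f_inv_into_f intro!: map_idI)
    ultimately show ?thesis using rel by metis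
  qed
  ultimately show ?thesis unfolding isomorphic_def by blast
qed

text \<open>The number of interpretations of the symbols on the vertices \<open>0, \<dots>, K - 1\<close>. A structure on \<open>l\<close>
  elements, \<open>l \<le> K\<close>, is copied to \<open>0, \<dots>, l - 1\<close> by some numbering of its domain; so for each
  such \<open>l\<close> this bounds the number of isomorphism types of size \<open>l\<close>, independently of any ambient
  structure.\<close>

definition num_codes :: "'s lang \<Rightarrow> nat \<Rightarrow> nat" where
  "num_codes L K = card (Pow (SIGMA R:symbols L. tuples (arity L R) {..<K}))"

lemma finite_tuples: "finite V \<Longrightarrow> finite (tuples k V)"
  using finite_lists_length_eq[of V k] unfolding tuples_def
  by (rule rev_finite_subset) auto

text \<open>Even if \<open>C\<close> is infinite, \<open>prob B M\<close> takes only finitely many values as \<open>B\<close> varies: its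
  numerator is at most the number of induced substructures of \<open>M\<close>, and its denominator is \<open>0\<close> or
  one of finitely many binomial coefficients. So the maximum is attained.\<close>

lemma prob_le_prob_class:
  assumes "finite (univ M)" "B \<in> C"
  shows "prob B M \<le> prob_class C M"
proof -
  let ?S = "induced M ` Pow (univ M)"
  let ?n = "size_of M"
  have fS: "finite ?S" using assms by simp
  let ?V = "(\<lambda>(x, y). real x / real y) ` ({..card ?S} \<times> (insert 0 ((\<lambda>k. ?n choose k) ` {..?n})))"
  have "(\<lambda>B. prob B M) ` C \<subseteq> ?V"
  proof
    fix x assume "x \<in> (\<lambda>B. prob B M) ` C"
    then obtain B where x: "x = prob B M" by blast
    have "card {N. substructure N M \<and> isomorphic N B} \<le> card ?S"
      by (rule card_mono[OF fS]) (auto simp: substructure_iff_induced)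
    moreover have "?n choose (size_of B) \<in> insert 0 ((\<lambda>k. ?n choose k) ` {..?n})"
      by (cases "size_of B \<le> ?n") (auto simp: binomial_eq_0)
    ultimately show "x \<in> ?V"
      unfolding x prob_def by (intro image_eqI[where x = "(_, _)"]) auto
  qed
  then have "finite ((\<lambda>B. prob B M) ` C)"
    by (rule finite_subset) simp
  then show ?thesis
    using assms(2) unfolding prob_class_def by (auto intro: Max_ge)
qed

lemma isomorphic_if_same_code:
  assumes "bij_betw g {..<l} Y" "bij_betw h {..<l} Z" and "is_struct L M"
    and code: "\<And>R ts. R \<in> symbols L \<Longrightarrow> ts \<in> tuples (arity L R) {..<l} \<Longrightarrow>
      map g ts \<in> interp M R \<longleftrightarrow> map h ts \<in> interp M R"
  shows "isomorphic (induced M Y) (induced M Z)"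
proof -
  let ?g' = "inv_into {..<l} g"
  let ?f = "h \<circ> ?g'"
  have g': "bij_betw ?g' Y {..<l}" using assms(1) by (rule bij_betw_inv_into)
  then have f: "bij_betw ?f Y Z" using assms(2) by (rule bij_betw_trans)
  moreover have "a \<in> interp M R \<inter> lists Y \<longleftrightarrow> map ?f a \<in> interp M R \<inter> lists Z"
    if a: "a \<in> lists Y" for R a
  proof (cases "R \<in> symbols L \<and> length a = arity L R")
    case True
    let ?ts = "map ?g' a"
    have "?ts \<in> tuples (arity L R) {..<l}"
      using True a g' by (auto simp: tuples_def lists_eq_set bij_betw_def)
    moreover have "map g ?ts = a"
      using a assms(1) by (auto simp: lists_eq_set bij_betw_def f_inv_into_f intro!: map_idI)
    ultimately have "a \<in> interp M R \<longleftrightarrow> map ?f a \<in> interp M R"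
      using code[of R ?ts] True by (simp del: map_map add: map_map[symmetric])
    moreover have "map ?f a \<in> lists Z"
      using a f by (auto simp: lists_eq_set bij_betw_def)
    ultimately show ?thesis using a by blast
  next
    case False
    then have "a \<notin> interp M R" "map ?f a \<notin> interp M R"
      using is_structD[OF assms(3)] by (metis, metis length_map)
    then show ?thesis by blast
  qed
  ultimately show ?thesis unfolding isomorphic_def by auto
qed

text \<open>The hypothesis bounds the number of copies of each single isomorphism type in \<open>C\<close>; the
  sets \<open>Y\<close> are grouped by the code of their pattern, and the sets in one group all carry copies
  of the pattern of any one of them.\<close>

lemma card_sets_inducing_class:
  assumes M: "is_struct L M" "finite (univ M)" and L: "finite (symbols L)"
    and pc: "prob_class (up_to_size C K) M < \<epsilon>" and l: "1 \<le> l" "l \<le> K" "l \<le> size_of M"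
    and \<epsilon>: "0 \<le> \<epsilon>"
  shows "real (card {Y \<in> nsets (univ M) l. induced M Y \<in> C})
    \<le> real (num_codes L K) * (\<epsilon> * real (size_of M choose l))"
proof -
  let ?B = "{Y \<in> nsets (univ M) l. induced M Y \<in> C}"
  have "\<exists>g. bij_betw g {..<l} Y" if "Y \<in> nsets (univ M) l" for Y
    using that ex_bij_betw_nat_finite[of Y] by (auto simp: nsets_def atLeast0LessThan)
  then obtain g where g: "\<And>Y. Y \<in> nsets (univ M) l \<Longrightarrow> bij_betw (g Y) {..<l} Y"
    by metis
  define code where "code Y = {(R, ts). R \<in> symbols L \<and> ts \<in> tuples (arity L R) {..<l}
    \<and> map (g Y) ts \<in> interp M R}" for Y
  let ?P = "Pow (SIGMA R:symbols L. tuples (arity L R) {..<K})"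
  have fP: "finite ?P" using L by (auto intro!: finite_SigmaI finite_tuples)
  have codeP: "code ` ?B \<subseteq> ?P"
    using l by (auto simp: code_def tuples_def)
  have fB: "finite ?B" using M(2) by (simp add: finite_imp_finite_nsets)
  have group: "real (card {Y \<in> ?B. code Y = c}) \<le> \<epsilon> * real (size_of M choose l)" for c
  proof (cases "{Y \<in> ?B. code Y = c} = {}")
    case False
    then obtain Y0 where Y0: "Y0 \<in> ?B" "code Y0 = c" by blast
    let ?N = "{N. substructure N M \<and> isomorphic N (induced M Y0)}"
    have "induced M ` {Y \<in> ?B. code Y = c} \<subseteq> ?N"
    proof (safe)
      fix Y assume Y: "Y \<in> nsets (univ M) l" "c = code Y"
      then show "substructure (induced M Y) M"
        using l unfolding substructure_iff_induced by (auto simp: nsets_def intro!: exI[of _ Y])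
      show "isomorphic (induced M Y) (induced M Y0)"
      proof (rule isomorphic_if_same_code[OF g g M(1)])
        show "Y \<in> nsets (univ M) l" "Y0 \<in> nsets (univ M) l" using Y Y0 by auto
        have "code Y = code Y0" using Y Y0 by simp
        then show "map (g Y) ts \<in> interp M R \<longleftrightarrow> map (g Y0) ts \<in> interp M R"
          if "R \<in> symbols L" "ts \<in> tuples (arity L R) {..<l}" for R ts
          using that unfolding code_def by blast
      qed
    qed
    moreover have "inj_on (induced M) {Y \<in> ?B. code Y = c}"
      by (rule inj_onI) (metis induced_simps(1))
    moreover have "finite ?N"
      by (rule finite_subset[of _ "induced M ` Pow (univ M)"])
        (use M(2) in \<open>auto simp: substructure_iff_induced\<close>)
    ultimately have "card {Y \<in> ?B. code Y = c} \<le> card ?N"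
      using card_inj_on_le by blast
    moreover have "prob (induced M Y0) M < \<epsilon>"
      using prob_le_prob_class[OF M(2), of "induced M Y0" "up_to_size C K"] Y0 l pc
      by (fastforce simp: up_to_size_def nsets_def)
    moreover have "size_of M choose l > 0" using l by simp
    ultimately show ?thesis
      using Y0 by (simp add: prob_def nsets_def divide_less_eq)
  next
    case True
    show ?thesis unfolding True using \<epsilon> by simp
  qed
  have "card ?B = (\<Sum>c\<in>code ` ?B. card {Y \<in> ?B. code Y = c})"
    using sum.image_gen[OF fB, of "\<lambda>_. 1::nat" code] by simp
  then have "real (card ?B) = (\<Sum>c\<in>code ` ?B. real (card {Y \<in> ?B. code Y = c}))"
    by simp
  also have "\<dots> \<le> real (card (code ` ?B)) * (\<epsilon> * real (size_of M choose l))"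
    by (rule sum_bounded_above) (rule group)
  also have "\<dots> \<le> real (num_codes L K) * (\<epsilon> * real (size_of M choose l))"
    using card_mono[OF fP codeP] \<epsilon> by (intro mult_right_mono) (auto simp: num_codes_def)
  finally show ?thesis .
qed

text \<open>A copy on \<open>l\<close> vertices lies in a fraction \<open>K choose l\<close> over \<open>n choose l\<close> of all \<open>K\<close>-sets, so few
  copies of every size spoil few \<open>K\<close>-sets; the factor \<open>2 ^ K\<close> is the sum of \<open>K choose l\<close>
  over \<open>l\<close>.\<close>

lemma card_sets_containing_class:
  assumes M: "is_struct L M" "finite (univ M)" and L: "finite (symbols L)"
    and pc: "prob_class (up_to_size C K) M < \<epsilon>" and K: "K \<le> size_of M"
    and \<epsilon>: "0 \<le> \<epsilon>"
  shows "real (card {X \<in> nsets (univ M) K. \<exists>Y\<subseteq>X. Y \<noteq> {} \<and> induced M Y \<in> C})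
    \<le> real (num_codes L K) * 2 ^ K * \<epsilon> * real (size_of M choose K)"
proof -
  let ?n = "size_of M" and ?T = "real (num_codes L K)"
  let ?B = "\<lambda>l. {Y \<in> nsets (univ M) l. induced M Y \<in> C}"
  let ?U = "\<lambda>Y. {X \<in> nsets (univ M) K. Y \<subseteq> X}"
  have fB: "finite (?B l)" for l using M(2) by (simp add: finite_imp_finite_nsets)
  have fU: "finite (?U Y)" for Y using M(2) by (simp add: finite_imp_finite_nsets)
  have "{X \<in> nsets (univ M) K. \<exists>Y\<subseteq>X. Y \<noteq> {} \<and> induced M Y \<in> C} \<subseteq> (\<Union>l\<in>{1..K}. \<Union>Y\<in>?B l. ?U Y)"
  proof
    fix X assume "X \<in> {X \<in> nsets (univ M) K. \<exists>Y\<subseteq>X. Y \<noteq> {} \<and> induced M Y \<in> C}"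
    then obtain Y where X: "X \<in> nsets (univ M) K" and Y: "Y \<subseteq> X" "Y \<noteq> {}" "induced M Y \<in> C"
      by blast
    then have fin: "finite Y" "card Y \<le> K" "Y \<subseteq> univ M"
      by (auto simp: nsets_def intro: finite_subset card_mono)
    then have "card Y \<in> {1..K}" using Y(2) by (simp add: Suc_le_eq card_gt_0_iff)
    moreover have "Y \<in> ?B (card Y)" using fin Y by (auto simp: nsets_def)
    ultimately show "X \<in> (\<Union>l\<in>{1..K}. \<Union>Y\<in>?B l. ?U Y)" using X Y(1) by blast
  qed
  then have "card {X \<in> nsets (univ M) K. \<exists>Y\<subseteq>X. Y \<noteq> {} \<and> induced M Y \<in> C}
      \<le> card (\<Union>l\<in>{1..K}. \<Union>Y\<in>?B l. ?U Y)"
    by (rule card_mono[rotated]) (use fB fU in auto)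
  also have "\<dots> \<le> (\<Sum>l\<in>{1..K}. card (\<Union>Y\<in>?B l. ?U Y))"
    by (rule card_UN_le) simp
  also have "\<dots> \<le> (\<Sum>l\<in>{1..K}. \<Sum>Y\<in>?B l. card (?U Y))"
    by (intro sum_mono card_UN_le fB)
  also have "\<dots> = (\<Sum>l\<in>{1..K}. \<Sum>Y\<in>?B l. ((?n - l) choose (K - l)))"
  proof (intro sum.cong refl)
    fix l Y assume "l \<in> {1..K}" "Y \<in> ?B l"
    then show "card (?U Y) = (?n - l) choose (K - l)"
      using card_nsets_above[OF M(2), of Y K] by (auto simp: nsets_def)
  qed
  finally have "real (card {X \<in> nsets (univ M) K. \<exists>Y\<subseteq>X. Y \<noteq> {} \<and> induced M Y \<in> C})
      \<le> real (\<Sum>l\<in>{1..K}. \<Sum>Y\<in>?B l. ((?n - l) choose (K - l)))"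
    by (simp only: of_nat_le_iff)
  also have "\<dots> = (\<Sum>l\<in>{1..K}. real (card (?B l)) * real ((?n - l) choose (K - l)))"
    by simp
  also have "\<dots> \<le> (\<Sum>l\<in>{1..K}. ?T * (\<epsilon> * real (?n choose l)) * real ((?n - l) choose (K - l)))"
    using K by (intro sum_mono mult_right_mono card_sets_inducing_class[OF M L pc _ _ _ \<epsilon>]) auto
  also have "\<dots> = (\<Sum>l\<in>{1..K}. ?T * \<epsilon> * real (?n choose K) * real (K choose l))"
  proof (intro sum.cong refl)
    fix l assume "l \<in> {1..K}"
    then have "(?n choose K) * (K choose l) = (?n choose l) * ((?n - l) choose (K - l))"
      using choose_mult[of l K ?n] K by simp
    then have "real (?n choose l) * real ((?n - l) choose (K - l)) = real (?n choose K) * real (K choose l)"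
      by (metis of_nat_mult)
    then show "?T * (\<epsilon> * real (?n choose l)) * real ((?n - l) choose (K - l))
        = ?T * \<epsilon> * real (?n choose K) * real (K choose l)"
      by (simp add: mult.assoc)
  qed
  also have "\<dots> = ?T * \<epsilon> * real (?n choose K) * real (\<Sum>l\<in>{1..K}. K choose l)"
    by (simp add: sum_distrib_left)
  also have "\<dots> \<le> ?T * \<epsilon> * real (?n choose K) * real (2 ^ K)"
  proof (rule mult_left_mono)
    have "(\<Sum>l\<in>{1..K}. K choose l) \<le> (\<Sum>l\<le>K. K choose l)"
      by (rule sum_mono2) auto
    then show "real (\<Sum>l\<in>{1..K}. K choose l) \<le> real (2 ^ K)"
      by (simp only: choose_row_sum of_nat_le_iff)
  qed (use \<epsilon> in simp)
  finally show ?thesis by (simp add: mult_ac)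
qed

section \<open>Types and diagrams\<close>

lemma sat_map_qf: "sat M h (map_qf (\<lambda>R. R) g \<phi>) \<longleftrightarrow> sat M (h \<circ> g) \<phi>"
  by (induction \<phi>) (auto simp: comp_def)

lemma wf_map_qf: "wf_qf L S \<phi> \<Longrightarrow> g ` S \<subseteq> T \<Longrightarrow> wf_qf L T (map_qf (\<lambda>R. R) g \<phi>)"
  by (induction \<phi>) (auto simp: tuples_def)

lemma map_qf_idem:
  "wf_qf L S \<phi> \<Longrightarrow> (\<And>x. x \<in> S \<Longrightarrow> g x = x) \<Longrightarrow> map_qf (\<lambda>R. R) g \<phi> = \<phi>"
  by (induction \<phi>) (auto simp: tuples_def intro!: map_idI)

text \<open>Every comparison of satisfaction below, between a structure and an induced substructure, a
  type and its instance, or two types, is reduced by this to atoms.\<close>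

lemma sat_eq_if_atoms_eq:
  assumes "wf_qf L S \<phi>"
    and "\<And>s t. s \<in> S \<Longrightarrow> t \<in> S \<Longrightarrow> h s = h t \<longleftrightarrow> k s = k t"
    and "\<And>R ts. R \<in> symbols L \<Longrightarrow> ts \<in> tuples (arity L R) S \<Longrightarrow>
      map h ts \<in> interp M R \<longleftrightarrow> map k ts \<in> interp N R"
  shows "sat M h \<phi> \<longleftrightarrow> sat N k \<phi>"
  using assms(1) by (induction \<phi>) (auto simp: assms(2,3))

lemma Diag_induced:
  assumes "A \<subseteq> X"
  shows "Diag L (induced N X) A = Diag L N A"
proof -
  have "sat (induced N X) (\<lambda>v. v) \<phi> \<longleftrightarrow> sat N (\<lambda>v. v) \<phi>" if "wf_qf L A \<phi>" for \<phi>
    using assms by (intro sat_eq_if_atoms_eq[OF that]) (auto simp: tuples_def lists_eq_set)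
  then show ?thesis unfolding Diag_def by blast
qed

lemma Rel_in_Diag_iff:
  assumes "R \<in> symbols L" "ts \<in> tuples (arity L R) A"
  shows "Rel R ts \<in> Diag L N A \<longleftrightarrow> ts \<in> interp N R"
  using assms by (simp add: Diag_def)

text \<open>A relational language of maximum arity \<open>r\<close> only speaks about \<open>r\<close> elements at a time.\<close>

lemma struct_eq_if_Diag_eq:
  assumes "is_struct L N" "is_struct L N'" "univ N' = univ N"
    and "finite (univ N)" "r \<le> size_of N" "\<And>R. R \<in> symbols L \<Longrightarrow> arity L R \<le> r"
    and Diag: "\<And>A. A \<in> nsets (univ N) r \<Longrightarrow> Diag L N A = Diag L N' A"
  shows "N = N'"
proof -
  have "ts \<in> interp N R \<longleftrightarrow> ts \<in> interp N' R" for R ts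
  proof (cases "R \<in> symbols L \<and> length ts = arity L R \<and> set ts \<subseteq> univ N")
    case True
    then have "card (set ts) \<le> r"
      using assms(6)[of R] card_length[of ts] by linarith
    then obtain A where A: "set ts \<subseteq> A" "A \<in> nsets (univ N) r"
      using nset_extends[of "set ts" "univ N" r] True assms(4,5) by blast
    then have "ts \<in> tuples (arity L R) A" using True by (simp add: tuples_def)
    then show ?thesis using Rel_in_Diag_iff[of R L ts A] Diag[OF A(2)] True by metis
  next
    case False
    then show ?thesis
      using is_structD[OF assms(1)] is_structD[OF assms(2)] assms(3) by metis
  qed
  then have "interp N = interp N'" by (intro ext set_eqI)
  then show ?thesis using assms(3) by (intro rel_struct.equality) simp_all
qed

locale hereditary_lang_property =
  fixes L :: "'s lang" and H :: "('s, 'v) rel_struct set"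
  assumes finite_lang: "finite_lang L" and hereditary: "hereditary_property L H"
begin

abbreviation r :: nat where "r \<equiv> max_arity L"

lemma finite_symbols: "finite (symbols L)"
  using finite_lang by (simp add: finite_lang_def)

lemma arity_le: "R \<in> symbols L \<Longrightarrow> arity L R \<le> r"
  using finite_lang unfolding max_arity_def finite_lang_def by (intro Max_ge) auto

lemma arity_pos: "R \<in> symbols L \<Longrightarrow> 1 \<le> arity L R"
  using finite_lang unfolding finite_lang_def by auto

lemma r_pos: "1 \<le> r"
proof -
  obtain R where "R \<in> symbols L" using finite_lang unfolding finite_lang_def by auto
  then show ?thesis using arity_le arity_pos le_trans by blast
qed

lemma S_types_realized:
  assumes "p \<in> S_types L H"
  obtains G b where "G \<in> H" "length b = r" "distinct b" "p = {\<phi>. wf_qf L {..<r} \<phi> \<and> sat G (\<lambda>i. b ! i) \<phi>}"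
proof -
  obtain G b where G: "G \<in> H" "b \<in> tuples r (univ G)" "\<forall>\<phi>\<in>p. sat G (\<lambda>i. b ! i) \<phi>"
    using assms unfolding S_types_def realized_in_def by blast
  have c: "complete_type L r p" "proper_type r p" using assms unfolding S_types_def by auto
  have "distinct b"
    unfolding distinct_conv_nth
  proof (intro allI impI)
    fix i j assume "i < length b" "j < length b" "i \<noteq> j"
    then have "Neg (Eq i j) \<in> p" using G(2) c(2) by (simp add: proper_type_def tuples_def)
    then have "sat G (\<lambda>i. b ! i) (Neg (Eq i j))" using G(3) by blast
    then show "b ! i \<noteq> b ! j" by simp
  qed
  moreover have "p = {\<phi>. wf_qf L {..<r} \<phi> \<and> sat G (\<lambda>i. b ! i) \<phi>}"
  proof (intro set_eqI iffI)
    show "\<phi> \<in> {\<phi>. wf_qf L {..<r} \<phi> \<and> sat G (\<lambda>i. b ! i) \<phi>}" if "\<phi> \<in> p" for \<phi>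
      using that c(1) G(3) unfolding complete_type_def by blast
    show "\<phi> \<in> p" if "\<phi> \<in> {\<phi>. wf_qf L {..<r} \<phi> \<and> sat G (\<lambda>i. b ! i) \<phi>}" for \<phi>
      using that c(1) G(3) sat.simps(3) unfolding complete_type_def by blast
  qed
  moreover have "length b = r" using G(2) by (simp add: tuples_def)
  ultimately show ?thesis using that[OF G(1)] by blast
qed

text \<open>An instance of a type at a tuple of distinct constants is a diagram, except that it lives
  in some \<open>G \<in> H\<close> and is pulled back along an injective map of constants.\<close>

lemma inst_S_types_sat:
  fixes a :: "'t list"
  assumes p: "p \<in> S_types L H" and a: "length a = r" "distinct a"
  obtains G c where "G \<in> H" "inj_on c (set a)" "inst p a = {\<psi>. wf_qf L (set a) \<psi> \<and> sat G c \<psi>}"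
proof -
  obtain G b where G: "G \<in> H" "length b = r" "distinct b"
    and p_eq: "p = {\<phi>. wf_qf L {..<r} \<phi> \<and> sat G (\<lambda>i. b ! i) \<phi>}"
    using S_types_realized[OF p] .
  let ?a = "\<lambda>i. a ! i"
  let ?i = "inv_into {..<r} ?a"
  have bij: "bij_betw ?a {..<r} (set a)" using a by (intro bij_betw_nth) auto
  then have bij': "bij_betw ?i (set a) {..<r}" by (rule bij_betw_inv_into)
  define c where "c = (\<lambda>i. b ! i) \<circ> ?i"
  have "bij_betw (\<lambda>i. b ! i) {..<r} (set b)" using G by (intro bij_betw_nth) auto
  then have "inj_on c (set a)"
    unfolding c_def using bij' by (metis bij_betw_imp_inj_on bij_betw_trans)
  moreover have "inst p a = {\<psi>. wf_qf L (set a) \<psi> \<and> sat G c \<psi>}"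
  proof (intro set_eqI iffI)
    fix \<psi> assume "\<psi> \<in> inst p a"
    then obtain \<phi> where \<phi>: "\<phi> \<in> p" "\<psi> = map_qf (\<lambda>R. R) ?a \<phi>" unfolding inst_def by blast
    have wf: "wf_qf L {..<r} \<phi>" and sat: "sat G (\<lambda>i. b ! i) \<phi>" using \<phi>(1) p_eq by auto
    have ca: "(c \<circ> ?a) i = b ! i" if "i < r" for i
      using that bij by (simp add: c_def bij_betw_inv_into_left)
    then have "map (c \<circ> ?a) ts = map (\<lambda>i. b ! i) ts" if "ts \<in> tuples k {..<r}" for ts k
      using that unfolding tuples_def map_eq_conv by blast
    then have "sat G (c \<circ> ?a) \<phi> \<longleftrightarrow> sat G (\<lambda>i. b ! i) \<phi>"
      using ca by (intro sat_eq_if_atoms_eq[OF wf]) (simp_all only: lessThan_iff)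
    then have "sat G c \<psi>" using sat \<phi>(2) by (simp add: sat_map_qf)
    moreover have "wf_qf L (set a) \<psi>"
      using wf_map_qf[OF wf, of ?a] bij \<phi>(2) by (auto simp: bij_betw_def)
    ultimately show "\<psi> \<in> {\<psi>. wf_qf L (set a) \<psi> \<and> sat G c \<psi>}" by blast
  next
    fix \<psi> assume \<psi>: "\<psi> \<in> {\<psi>. wf_qf L (set a) \<psi> \<and> sat G c \<psi>}"
    let ?\<phi> = "map_qf (\<lambda>R. R) ?i \<psi>"
    have "wf_qf L {..<r} ?\<phi>" using \<psi> bij' by (auto intro!: wf_map_qf simp: bij_betw_def)
    moreover have "sat G (\<lambda>i. b ! i) ?\<phi>" using \<psi> by (simp add: sat_map_qf c_def)
    ultimately have "?\<phi> \<in> p" using p_eq by blast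
    moreover have "map_qf (\<lambda>R. R) ?a ?\<phi> = \<psi>"
    proof -
      have "map_qf (\<lambda>R. R) ?a ?\<phi> = map_qf (\<lambda>R. R) (?a \<circ> ?i) \<psi>"
        by (simp add: qf.map_comp comp_def)
      also have "\<dots> = \<psi>"
        using \<psi> bij by (intro map_qf_idem) (auto simp: bij_betw_inv_into_right)
      finally show ?thesis .
    qed
    ultimately show "\<psi> \<in> inst p a" unfolding inst_def by (metis image_eqI)
  qed
  ultimately show ?thesis using that G(1) by blast
qed

lemma Neg_in_inst:
  assumes p: "p \<in> S_types L H" "length a = r" "distinct a"
    and \<psi>: "wf_qf L (set a) \<psi>" "\<psi> \<notin> inst p a"
  shows "Neg \<psi> \<in> inst p a"
proof -
  obtain G c where "G \<in> H" "inj_on c (set a)" and eq: "inst p a = {\<psi>. wf_qf L (set a) \<psi> \<and> sat G c \<psi>}"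
    using inst_S_types_sat[OF p] .
  show ?thesis using \<psi> unfolding eq by simp
qed

text \<open>Since \<open>p\<close> is complete and proper, agreement on relational atoms is enough.\<close>

lemma Diag_eq_inst:
  assumes p: "p \<in> S_types L H" and a: "length a = r" "distinct a"
    and N: "\<And>R ts. R \<in> symbols L \<Longrightarrow> ts \<in> tuples (arity L R) (set a) \<Longrightarrow>
      ts \<in> interp N R \<longleftrightarrow> Rel R ts \<in> inst p a"
  shows "Diag L N (set a) = inst p a"
proof -
  obtain G c where "G \<in> H" and c: "inj_on c (set a)" and eq: "inst p a = {\<psi>. wf_qf L (set a) \<psi> \<and> sat G c \<psi>}"
    using inst_S_types_sat[OF p a] .
  have "sat N (\<lambda>v. v) \<psi> \<longleftrightarrow> sat G c \<psi>" if "wf_qf L (set a) \<psi>" for \<psi>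
  proof (rule sat_eq_if_atoms_eq[OF that])
    show "s = t \<longleftrightarrow> c s = c t" if "s \<in> set a" "t \<in> set a" for s t
      using c that by (auto dest: inj_onD)
    show "map (\<lambda>v. v) ts \<in> interp N R \<longleftrightarrow> map c ts \<in> interp G R"
      if "R \<in> symbols L" "ts \<in> tuples (arity L R) (set a)" for R ts
      using N[OF that] that by (simp add: eq)
  qed
  then show ?thesis unfolding eq Diag_def by blast
qed

text \<open>A type contains infinitely many formulas, but as it is realized by distinct elements it is
  determined by the finitely many relational atoms in it.\<close>

lemma finite_S_types: "finite (S_types L H)"
proof -
  let ?Rels = "\<Union>R\<in>symbols L. Rel R ` tuples (arity L R) {..<r}"
  have "inj_on (\<lambda>p. p \<inter> ?Rels) (S_types L H)"
  proof (rule inj_onI)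
    fix p q assume p: "p \<in> S_types L H" and q: "q \<in> S_types L H" and eq: "p \<inter> ?Rels = q \<inter> ?Rels"
    obtain G b where "G \<in> H" and G: "length b = r" "distinct b" "p = {\<phi>. wf_qf L {..<r} \<phi> \<and> sat G (\<lambda>i. b ! i) \<phi>}"
      using S_types_realized[OF p] .
    obtain G' b' where "G' \<in> H" and G': "length b' = r" "distinct b'" "q = {\<phi>. wf_qf L {..<r} \<phi> \<and> sat G' (\<lambda>i. b' ! i) \<phi>}"
      using S_types_realized[OF q] .
    have "sat G (\<lambda>i. b ! i) \<phi> \<longleftrightarrow> sat G' (\<lambda>i. b' ! i) \<phi>" if "wf_qf L {..<r} \<phi>" for \<phi>
    proof (rule sat_eq_if_atoms_eq[OF that])
      show "b ! s = b ! t \<longleftrightarrow> b' ! s = b' ! t" if "s \<in> {..<r}" "t \<in> {..<r}" for s t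
        using that G(1,2) G'(1,2) by (simp add: nth_eq_iff_index_eq)
      show "map (\<lambda>i. b ! i) ts \<in> interp G R \<longleftrightarrow> map (\<lambda>i. b' ! i) ts \<in> interp G' R"
        if "R \<in> symbols L" "ts \<in> tuples (arity L R) {..<r}" for R ts
      proof -
        have "Rel R ts \<in> p \<longleftrightarrow> Rel R ts \<in> q" using that eq by blast
        then show ?thesis using that G(3) G'(3) by simp
      qed
    qed
    then show "p = q" using G(3) G'(3) by blast
  qed
  moreover have "finite (Pow ?Rels)"
    using finite_symbols finite_tuples by auto
  moreover have "(\<lambda>p. p \<inter> ?Rels) ` S_types L H \<subseteq> Pow ?Rels" by blast
  ultimately show ?thesis using inj_on_finite by blast
qed

lemma finite_type_lang: "finite (symbols (type_lang L H))"
  using finite_S_types by (simp add: type_lang_def)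

section \<open>Choices in a pattern\<close>

text \<open>An upper bound for the number of choices at a single \<open>r\<close>-set: a type and an
  enumeration, the enumerations being counted generously as all \<open>r ^ r\<close> lists.\<close>

definition max_choices :: nat where
  "max_choices = card (S_types L H) * r ^ r"

lemma Ch_bounded:
  assumes "A \<in> nsets V r"
  shows "finite (Ch L H M A)" "card (Ch L H M A) \<le> max_choices"
proof -
  have A: "finite A" "card A = r" using assms by (auto simp: nsets_def)
  let ?T = "{a. set a \<subseteq> A \<and> length a = r}"
  have sub: "Ch L H M A \<subseteq> (\<lambda>(p, a). inst p a) ` (S_types L H \<times> ?T)"
    by (auto simp: Ch_def dtuples_def tuples_def)
  have fin: "finite (S_types L H \<times> ?T)"
    using finite_S_types finite_lists_length_eq[OF A(1)] by simp
  show "finite (Ch L H M A)" using finite_subset[OF sub] fin by blast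
  have "card (Ch L H M A) \<le> card (S_types L H \<times> ?T)"
    using surj_card_le[OF fin sub] .
  then show "card (Ch L H M A) \<le> max_choices"
    using card_lists_length_eq[OF A(1), of r] A(2) by (simp add: card_cartesian_product max_choices_def)
qed

lemma Ch_nonempty:
  assumes "complete_pat L H M" "A \<in> nsets (univ M) r"
  shows "Ch L H M A \<noteq> {}"
proof -
  obtain a p where "a \<in> dtuples r (univ M)" "set a = A" "p \<in> S_types L H" "a \<in> interp M p"
    using assms unfolding complete_pat_def by metis
  then have "inst p a \<in> Ch L H M A" by (auto simp: Ch_def)
  then show ?thesis by blast
qed

lemma card_Ch_pos:
  assumes "complete_pat L H M" "A \<in> nsets (univ M) r"
  shows "0 < card (Ch L H M A)"
  using Ch_nonempty[OF assms] Ch_bounded(1)[OF assms(2)] by (simp add: card_gt_0_iff)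

lemma choice_function_iff:
  "choice_function L H M \<chi> \<longleftrightarrow> (\<forall>A\<in>nsets (univ M) r. \<chi> A \<in> Ch L H M A)"
proof -
  have "Ch L H M A \<subseteq> S_types_const L H (univ M)" for A
    by (auto simp: Ch_def S_types_const_def)
  then show ?thesis unfolding choice_function_def by blast
qed

text \<open>The choice function that chooses \<open>N\<close> can only be \<open>A \<mapsto> Diag L N A\<close>, so it need not be
  mentioned.\<close>

lemma full_subpattern_iff:
  "full_subpattern L H N M \<longleftrightarrow>
    is_struct L N \<and> univ N = univ M \<and> (\<forall>A\<in>nsets (univ M) r. Diag L N A \<in> Ch L H M A)"
proof
  assume "full_subpattern L H N M"
  then show "is_struct L N \<and> univ N = univ M \<and> (\<forall>A\<in>nsets (univ M) r. Diag L N A \<in> Ch L H M A)"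
    unfolding full_subpattern_def choice_function_iff chosen_subpattern_def by metis
next
  assume "is_struct L N \<and> univ N = univ M \<and> (\<forall>A\<in>nsets (univ M) r. Diag L N A \<in> Ch L H M A)"
  then have "choice_function L H M (Diag L N) \<and> chosen_subpattern L N (Diag L N) M"
    unfolding choice_function_iff chosen_subpattern_def by blast
  then show "full_subpattern L H N M" unfolding full_subpattern_def by blast
qed

lemma finite_choice_functions:
  "finite (univ M) \<Longrightarrow> finite (\<Pi>\<^sub>E A\<in>nsets (univ M) r. Ch L H M A)"
  by (intro finite_PiE finite_imp_finite_nsets Ch_bounded(1))

text \<open>A full subpattern \<open>N\<close> is determined by the choice function \<open>A \<mapsto> Diag L N A\<close>. Having at least
  \<open>r\<close> vertices matters: otherwise there are no \<open>r\<close>-sets, and nothing is determined.\<close>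

lemma sub_le_prod_Ch:
  assumes "finite (univ M)" "r \<le> size_of M"
  shows "finite {N. full_subpattern L H N M}"
    and "sub L H M \<le> (\<Prod>A\<in>nsets (univ M) r. card (Ch L H M A))"
proof -
  let ?V = "nsets (univ M) r"
  let ?P = "\<Pi>\<^sub>E A\<in>?V. Ch L H M A"
  let ?f = "\<lambda>N. restrict (Diag L N) ?V"
  have inj: "inj_on ?f {N. full_subpattern L H N M}"
  proof (rule inj_onI)
    fix N N' assume N: "N \<in> {N. full_subpattern L H N M}" "N' \<in> {N. full_subpattern L H N M}"
      and eq: "?f N = ?f N'"
    have st: "is_struct L N" "is_struct L N'" "univ N = univ M" "univ N' = univ M"
      using N unfolding full_subpattern_iff by simp_all
    have "Diag L N A = Diag L N' A" if "A \<in> ?V" for A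
      using fun_cong[OF eq, of A] that by simp
    then show "N = N'"
      using st assms arity_le by (intro struct_eq_if_Diag_eq[of L N N' r]) simp_all
  qed
  have img: "?f ` {N. full_subpattern L H N M} \<subseteq> ?P"
    unfolding full_subpattern_iff by auto
  show "finite {N. full_subpattern L H N M}"
    using inj_on_finite[OF inj img finite_choice_functions[OF assms(1)]] .
  have "sub L H M \<le> card ?P"
    using card_inj_on_le[OF inj img finite_choice_functions[OF assms(1)]] by (simp add: sub_def)
  then show "sub L H M \<le> (\<Prod>A\<in>?V. card (Ch L H M A))"
    using assms(1) by (simp add: card_PiE finite_imp_finite_nsets)
qed

text \<open>In an \<open>H\<close>-random pattern every choice function is realized, and different ones choose
  different structures, because the choice at \<open>A\<close> is the diagram of \<open>A\<close>.\<close>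

lemma prod_Ch_le_sub:
  assumes "finite (univ M)" "r \<le> size_of M" "H_random L H M"
  shows "(\<Prod>A\<in>nsets (univ M) r. card (Ch L H M A)) \<le> sub L H M"
proof -
  let ?V = "nsets (univ M) r"
  let ?P = "\<Pi>\<^sub>E A\<in>?V. Ch L H M A"
  have "\<exists>N. chosen_subpattern L N \<chi> M" if "\<chi> \<in> ?P" for \<chi>
  proof -
    have "choice_function L H M \<chi>" using that unfolding choice_function_iff by blast
    then show ?thesis using assms(3) unfolding H_random_def by blast
  qed
  then obtain N where N: "\<And>\<chi>. \<chi> \<in> ?P \<Longrightarrow> chosen_subpattern L (N \<chi>) \<chi> M"
    by metis
  have "inj_on N ?P"
  proof (rule inj_onI)
    fix \<chi> \<chi>' assume \<chi>: "\<chi> \<in> ?P" "\<chi>' \<in> ?P" "N \<chi> = N \<chi>'"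
    have "\<chi> A = \<chi>' A" if "A \<in> ?V" for A
      using N[OF \<chi>(1)] N[OF \<chi>(2)] \<chi>(3) that unfolding chosen_subpattern_def by metis
    then show "\<chi> = \<chi>'" by (rule PiE_ext[OF \<chi>(1,2)])
  qed
  moreover have "N ` ?P \<subseteq> {N. full_subpattern L H N M}"
  proof
    fix N' assume "N' \<in> N ` ?P"
    then obtain \<chi> where \<chi>: "\<chi> \<in> ?P" "N' = N \<chi>" by blast
    then have "choice_function L H M \<chi>" unfolding choice_function_iff by blast
    then show "N' \<in> {N. full_subpattern L H N M}"
      using N[OF \<chi>(1)] \<chi>(2) unfolding full_subpattern_def by blast
  qed
  ultimately have "card ?P \<le> sub L H M"
    unfolding sub_def by (rule card_inj_on_le) (rule sub_le_prod_Ch(1)[OF assms(1,2)])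
  then show ?thesis using assms(1) by (simp add: card_PiE finite_imp_finite_nsets)
qed

text \<open>The logarithm of the number of choice functions. It is additive over the \<open>r\<close>-sets, so it can
  be averaged over induced patterns, which \<open>sub\<close> cannot. For finite complete patterns on at
  least \<open>r\<close> vertices, its exponential bounds \<open>sub L H M\<close> from above, and equals it when \<open>M\<close> is
  \<open>H\<close>-random.\<close>

definition log_choices :: "('s, 'v) pat \<Rightarrow> real" where
  "log_choices M = (\<Sum>A\<in>nsets (univ M) r. ln (real (card (Ch L H M A))))"

lemma exp_log_choices:
  assumes "finite (univ M)" "complete_pat L H M"
  shows "exp (log_choices M) = real (\<Prod>A\<in>nsets (univ M) r. card (Ch L H M A))"
  using card_Ch_pos[OF assms(2)] assms(1)
  by (simp add: log_choices_def exp_sum finite_imp_finite_nsets)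

lemma sub_le_exp_log_choices:
  assumes "finite (univ M)" "r \<le> size_of M" "complete_pat L H M"
  shows "real (sub L H M) \<le> exp (log_choices M)"
  unfolding exp_log_choices[OF assms(1,3)] of_nat_le_iff by (rule sub_le_prod_Ch(2)[OF assms(1,2)])

lemma exp_log_choices_le_sub:
  assumes "finite (univ M)" "r \<le> size_of M" "H_random L H M"
  shows "exp (log_choices M) \<le> real (sub L H M)"
proof -
  have complete: "complete_pat L H M" using assms(3) by (simp add: H_random_def)
  show ?thesis
    unfolding exp_log_choices[OF assms(1) complete] of_nat_le_iff by (rule prod_Ch_le_sub[OF assms])
qed

lemma log_choices_le:
  assumes "finite (univ M)" "complete_pat L H M"
  shows "log_choices M \<le> real (size_of M choose r) * ln (1 + real max_choices)"
proof -
  have "log_choices M \<le> (\<Sum>A\<in>nsets (univ M) r. ln (1 + real max_choices))"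
    unfolding log_choices_def
  proof (rule sum_mono)
    fix A assume A: "A \<in> nsets (univ M) r"
    have "real (card (Ch L H M A)) \<le> 1 + real max_choices"
      using Ch_bounded(2)[OF A, of M] by linarith
    then show "ln (real (card (Ch L H M A))) \<le> ln (1 + real max_choices)"
      using card_Ch_pos[OF assms(2) A] by (intro ln_mono) simp_all
  qed
  then show ?thesis using card_nsets[OF assms(1)] by simp
qed

section \<open>Induced templates\<close>

lemma dtuples_mono: "X \<subseteq> V \<Longrightarrow> dtuples k X \<subseteq> dtuples k V"
  by (auto simp: dtuples_def tuples_def)

lemma Ch_induced:
  assumes "A \<subseteq> X" "X \<subseteq> univ M"
  shows "Ch L H (induced M X) A = Ch L H M A"
  using assms unfolding Ch_def dtuples_def tuples_def by (auto simp: lists_eq_set)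

lemma complete_pat_induced:
  assumes "complete_pat L H M" "X \<subseteq> univ M"
  shows "complete_pat L H (induced M X)"
  unfolding complete_pat_def
proof
  fix A assume A: "A \<in> nsets (univ (induced M X)) r"
  then have "A \<subseteq> X" by (simp add: nsets_def)
  have "A \<in> nsets (univ M) r" using A nsets_mono[OF assms(2)] by auto
  then obtain a p where a: "a \<in> dtuples r (univ M)" "set a = A" "p \<in> S_types L H" "a \<in> interp M p"
    using assms(1) unfolding complete_pat_def by blast
  then have "a \<in> dtuples r X" using \<open>A \<subseteq> X\<close> by (simp add: dtuples_def tuples_def)
  then show "\<exists>a\<in>dtuples r (univ (induced M X)). set a = A \<and> (\<exists>p\<in>S_types L H. a \<in> interp (induced M X) p)"
    using a \<open>A \<subseteq> X\<close> by (auto simp: lists_eq_set)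
qed

lemma template_induced:
  assumes "template L H M" "X \<subseteq> univ M" "X \<noteq> {}"
  shows "template L H (induced M X)"
proof -
  have M: "is_struct (type_lang L H) M" "complete_pat L H M"
    and distinct: "\<And>p a. p \<in> S_types L H \<Longrightarrow> a \<in> tuples r (univ M) - dtuples r (univ M) \<Longrightarrow> a \<notin> interp M p"
    and sym: "\<And>p p' \<mu> a. p \<in> S_types L H \<Longrightarrow> p' \<in> S_types L H \<Longrightarrow> \<mu> permutes {..<r} \<Longrightarrow>
      inst p [0..<r] = inst p' (permute_list \<mu> [0..<r]) \<Longrightarrow> a \<in> dtuples r (univ M) \<Longrightarrow>
      a \<in> interp M p \<longleftrightarrow> permute_list \<mu> a \<in> interp M p'"
    using assms(1) unfolding template_def Let_def by blast+
  have "a \<notin> interp (induced M X) p" if "p \<in> S_types L H" "a \<in> tuples r X - dtuples r X" for p a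
  proof -
    have "a \<in> tuples r (univ M) - dtuples r (univ M)"
      using that assms(2) by (auto simp: dtuples_def tuples_def)
    then show ?thesis using distinct that by simp
  qed
  moreover have "a \<in> interp (induced M X) p \<longleftrightarrow> permute_list \<mu> a \<in> interp (induced M X) p'"
    if "p \<in> S_types L H" "p' \<in> S_types L H" "\<mu> permutes {..<r}"
      "inst p [0..<r] = inst p' (permute_list \<mu> [0..<r])" and a: "a \<in> dtuples r X" for p p' \<mu> a
  proof -
    have "set (permute_list \<mu> a) = set a" using a that(3) by (simp add: dtuples_def tuples_def)
    moreover have "a \<in> interp M p \<longleftrightarrow> permute_list \<mu> a \<in> interp M p'"
      using sym[OF that(1-4)] a dtuples_mono[OF assms(2)] by blast
    ultimately show ?thesis by (simp add: lists_eq_set)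
  qed
  ultimately show ?thesis
    unfolding template_def Let_def
    using is_struct_induced[OF M(1) assms(3)] complete_pat_induced[OF M(2) assms(2)]
    by (intro conjI ballI allI impI) (auto simp del: induced_simps(2))
qed

lemma sum_log_choices_induced:
  assumes "finite (univ M)" "r \<le> K"
  shows "(\<Sum>X\<in>nsets (univ M) K. log_choices (induced M X))
    = real ((size_of M - r) choose (K - r)) * log_choices M"
proof -
  have "log_choices (induced M X) = (\<Sum>A\<in>nsets X r. ln (real (card (Ch L H M A))))"
    if "X \<in> nsets (univ M) K" for X
    unfolding log_choices_def
    using that by (intro sum.cong) (simp_all add: Ch_induced nsets_def)
  then show ?thesis
    using sum_nsets_nsets[OF assms] by (simp add: log_choices_def)
qed

text \<open>A choice function on a subset extends to the whole vertex set, and \<open>H\<close> is closed under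
  substructures.\<close>

lemma H_random_induced:
  assumes "H_random L H M" "X \<subseteq> univ M" "X \<noteq> {}"
  shows "H_random L H (induced M X)"
  unfolding H_random_def
proof (intro conjI allI impI)
  have M: "complete_pat L H M" using assms(1) by (simp add: H_random_def)
  then show "complete_pat L H (induced M X)" using assms(2) by (rule complete_pat_induced)
  fix \<chi> assume \<chi>: "choice_function L H (induced M X) \<chi>"
  define \<chi>' where "\<chi>' A = (if A \<subseteq> X then \<chi> A else SOME q. q \<in> Ch L H M A)" for A
  have "\<chi>' A \<in> Ch L H M A" if A: "A \<in> nsets (univ M) r" for A
  proof (cases "A \<subseteq> X")
    case True
    then have "A \<in> nsets (univ (induced M X)) r" using A by (simp add: nsets_def)
    then have "\<chi> A \<in> Ch L H (induced M X) A" using \<chi> unfolding choice_function_iff by blast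
    then show ?thesis unfolding Ch_induced[OF True assms(2)] using True by (simp add: \<chi>'_def)
  next
    case False
    then show ?thesis using Ch_nonempty[OF M A] by (simp add: \<chi>'_def some_in_eq)
  qed
  then have "choice_function L H M \<chi>'" unfolding choice_function_iff by blast
  then obtain N where N: "N \<in> H" "chosen_subpattern L N \<chi>' M"
    using assms(1) unfolding H_random_def by blast
  have "substructure (induced N X) N"
    using N(2) assms(2,3) unfolding chosen_subpattern_def by (auto simp: substructure_def)
  then have "induced N X \<in> H" using hereditary N(1) unfolding hereditary_property_def by blast
  moreover have "chosen_subpattern L (induced N X) \<chi> (induced M X)"
    unfolding chosen_subpattern_def
  proof (intro conjI ballI)
    show "is_struct L (induced N X)"
      using N(2) assms(3) by (simp add: is_struct_induced chosen_subpattern_def)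
    fix A assume A: "A \<in> nsets (univ (induced M X)) r"
    then have "A \<subseteq> X" "A \<in> nsets (univ M) r" using assms(2) by (auto simp: nsets_def)
    then show "Diag L (induced N X) A = \<chi> A"
      using N(2) by (simp add: Diag_induced chosen_subpattern_def \<chi>'_def)
  qed simp
  ultimately show "\<exists>N\<in>H. chosen_subpattern L N \<chi> (induced M X)" by blast
qed

text \<open>There may be infinitely many random templates of size \<open>n\<close>, as their domains vary; the maximum
  that defines \<open>ex_num\<close> exists because the values are bounded.\<close>

lemma sub_le_ex_num:
  assumes "M \<in> random_templates L H n" "r \<le> n"
  shows "sub L H M \<le> ex_num L H n"
proof -
  have "sub L H M \<le> nat \<lfloor>exp (real (n choose r) * ln (1 + real max_choices))\<rfloor>"
    if "M \<in> random_templates L H n" for M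
  proof -
    have M: "finite (univ M)" "size_of M = n" "complete_pat L H M"
      using that by (auto simp: random_templates_def H_random_def)
    then have "real (sub L H M) \<le> exp (log_choices M)"
      using sub_le_exp_log_choices assms(2) by blast
    also have "\<dots> \<le> exp (real (n choose r) * ln (1 + real max_choices))"
      using log_choices_le[OF M(1,3)] M(2) by simp
    finally show ?thesis by linarith
  qed
  then have "sub L H ` random_templates L H n \<subseteq> {..nat \<lfloor>exp (real (n choose r) * ln (1 + real max_choices))\<rfloor>}"
    by blast
  then have "finite (sub L H ` random_templates L H n)"
    by (rule finite_subset) simp
  then show ?thesis using assms(1) by (auto simp: ex_num_def)
qed

section \<open>Averaging over small subsets\<close>

text \<open>The average over all \<open>K\<close>-sets \<open>X\<close> of the density of \<open>log_choices (induced M X)\<close> is the density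
  of \<open>log_choices M\<close>. The good sets contribute at most \<open>\<beta>\<close>; the exceptional sets in \<open>B\<close>, a
  fraction \<open>\<eta>\<close> of all, contribute at most the trivial bound each.\<close>

lemma log_choices_averaging:
  assumes M: "complete_pat L H M" "finite (univ M)" and K: "r \<le> K" "K \<le> size_of M"
    and \<beta>: "0 \<le> \<beta>"
    and good: "\<And>X. X \<in> nsets (univ M) K \<Longrightarrow> X \<notin> B \<Longrightarrow>
      log_choices (induced M X) \<le> \<beta> * real (K choose r)"
    and B: "B \<subseteq> nsets (univ M) K" "real (card B) \<le> \<eta> * real (size_of M choose K)"
  shows "log_choices M \<le> (\<beta> + \<eta> * ln (1 + real max_choices)) * real (size_of M choose r)"
proof -
  let ?n = "size_of M" and ?U = "nsets (univ M) K" and ?\<Lambda> = "ln (1 + real max_choices)"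
  let ?f = "\<lambda>X. log_choices (induced M X)"
  have fU: "finite ?U" using M(2) by (rule finite_imp_finite_nsets)
  have cU: "card (?U - B) \<le> ?n choose K"
    using card_mono[OF fU, of "?U - B"] card_nsets[OF M(2), of K] by (metis Diff_subset)
  have \<Lambda>: "0 \<le> ?\<Lambda>" by simp
  have bad: "?f X \<le> real (K choose r) * ?\<Lambda>" if "X \<in> B" for X
  proof -
    have X: "X \<subseteq> univ M" "finite X" "card X = K" using that B(1) by (auto simp: nsets_def)
    show ?thesis
      using log_choices_le[of "induced M X"] complete_pat_induced[OF M(1) X(1)] X(2,3) by simp
  qed
  have "real ((?n - r) choose (K - r)) * log_choices M = sum ?f ?U"
    using sum_log_choices_induced[OF M(2) K(1)] by simp
  also have "\<dots> = sum ?f (?U - B) + sum ?f B"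
    by (rule sum.subset_diff[OF B(1) fU])
  also have "\<dots> \<le> real (card (?U - B)) * (\<beta> * real (K choose r)) + real (card B) * (real (K choose r) * ?\<Lambda>)"
    using good bad by (intro add_mono sum_bounded_above) auto
  also have "\<dots> \<le> real (?n choose K) * (\<beta> * real (K choose r))
      + (\<eta> * real (?n choose K)) * (real (K choose r) * ?\<Lambda>)"
  proof (intro add_mono mult_right_mono)
    show "real (card (?U - B)) \<le> real (?n choose K)" using cU by simp
    show "0 \<le> \<beta> * real (K choose r)" "0 \<le> real (K choose r) * ?\<Lambda>" using \<beta> \<Lambda> by simp_all
  qed (rule B(2))
  also have "\<dots> = (\<beta> + \<eta> * ?\<Lambda>) * (real (?n choose K) * real (K choose r))"
    by (simp add: algebra_simps)
  also have "real (?n choose K) * real (K choose r) = real (?n choose r) * real ((?n - r) choose (K - r))"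
    using choose_mult[OF K] by (metis of_nat_mult)
  finally have "real ((?n - r) choose (K - r)) * log_choices M
      \<le> real ((?n - r) choose (K - r)) * ((\<beta> + \<eta> * ?\<Lambda>) * real (?n choose r))"
    by (simp add: mult_ac)
  moreover have "0 < real ((?n - r) choose (K - r))" using K by simp
  ultimately show ?thesis by (simp only: mult_le_cancel_left_pos)
qed

lemma log_choices_le_ln_ex_num:
  assumes "M \<in> random_templates L H n" "r \<le> n"
  shows "0 < ex_num L H n" "log_choices M \<le> ln (real (ex_num L H n))"
proof -
  have M: "finite (univ M)" "size_of M = n" "H_random L H M"
    using assms(1) by (auto simp: random_templates_def)
  have "exp (log_choices M) \<le> real (sub L H M)"
    using exp_log_choices_le_sub M assms(2) by blast
  also have "\<dots> \<le> real (ex_num L H n)"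
    using sub_le_ex_num[OF assms] by simp
  finally have le: "exp (log_choices M) \<le> real (ex_num L H n)" .
  then show pos: "0 < ex_num L H n" using exp_gt_zero[of "log_choices M"] by linarith
  show "log_choices M \<le> ln (real (ex_num L H n))"
    using le pos by (simp add: ln_ge_iff)
qed

text \<open>Averaging without exceptional sets: every \<open>K\<close>-subset of an extremal random template of size
  \<open>n\<close> induces a random template of size \<open>K\<close>, so densities can only decrease with the size.\<close>

lemma ex_num_powr_antimono:
  assumes "r \<le> K" "K \<le> n"
  shows "real (ex_num L H n) powr (1 / real (n choose r)) \<le> real (ex_num L H K) powr (1 / real (K choose r))"
proof (cases "ex_num L H n = 0")
  case False
  then have "random_templates L H n \<noteq> {}" by (auto simp: ex_num_def split: if_splits)
  moreover have "finite (sub L H ` random_templates L H n)"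
  proof (rule finite_subset)
    show "sub L H ` random_templates L H n \<subseteq> {..ex_num L H n}"
      using sub_le_ex_num assms by force
  qed simp
  ultimately have "ex_num L H n \<in> sub L H ` random_templates L H n"
    unfolding ex_num_def by (simp add: Max_in)
  then obtain M where M: "M \<in> random_templates L H n" "sub L H M = ex_num L H n" by auto
  then have fin: "finite (univ M)" "size_of M = n" "H_random L H M" "template L H M"
    by (auto simp: random_templates_def)
  then have complete: "complete_pat L H M" by (simp add: H_random_def)
  let ?\<beta> = "ln (real (ex_num L H K)) / real (K choose r)"
  have rand: "induced M X \<in> random_templates L H K" if "X \<in> nsets (univ M) K" for X
  proof -
    have "X \<subseteq> univ M" "finite X" "card X = K" using that by (auto simp: nsets_def)
    moreover from this have "X \<noteq> {}" using r_pos assms(1) by auto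
    ultimately show ?thesis
      using template_induced[OF fin(4)] H_random_induced[OF fin(3)] by (simp add: random_templates_def)
  qed
  have good: "log_choices (induced M X) \<le> ?\<beta> * real (K choose r)" if "X \<in> nsets (univ M) K" for X
    using log_choices_le_ln_ex_num(2)[OF rand[OF that] assms(1)] assms(1) by simp
  obtain X where X: "X \<in> nsets (univ M) K"
    using nset_extends[of "{}" "univ M" K] fin assms(2) by auto
  have pos: "0 < ex_num L H K" using log_choices_le_ln_ex_num(1)[OF rand[OF X] assms(1)] .
  then have "0 \<le> ?\<beta>" by (simp add: Suc_le_eq)
  then have "log_choices M \<le> (?\<beta> + 0 * ln (1 + real max_choices)) * real (size_of M choose r)"
    using good assms(2) fin(2)
    by (intro log_choices_averaging[OF complete fin(1) assms(1), where B = "{}"]) (assumption | simp)+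
  then have "log_choices M \<le> ?\<beta> * real (n choose r)" using fin(2) by simp
  moreover have "ln (real (ex_num L H n)) \<le> log_choices M"
  proof -
    have "real (ex_num L H n) \<le> exp (log_choices M)"
      using sub_le_exp_log_choices[OF fin(1) _ complete] M(2) fin(2) assms by simp
    then have "ln (real (ex_num L H n)) \<le> ln (exp (log_choices M))"
      using False by (intro ln_mono) simp_all
    then show ?thesis by simp
  qed
  moreover have "0 < n choose r" using assms by simp
  ultimately have "ln (real (ex_num L H n)) / real (n choose r) \<le> ?\<beta>"
    by (simp add: pos_divide_le_eq)
  then show ?thesis using False pos by (simp add: powr_def)
qed simp

text \<open>The definition of \<open>ex_density\<close> by \<open>lim\<close> is meaningful only because the sequence converges. Antitonicity
  starts at index \<open>r\<close>, hence the shift.\<close>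

lemma ex_num_powr_tendsto:
  "(\<lambda>n. real (ex_num L H n) powr (1 / real (n choose r))) \<longlonglongrightarrow> ex_density L H" (is "?a \<longlonglongrightarrow> _")
proof -
  have "decseq (\<lambda>n. ?a (n + r))"
    by (intro decseq_SucI ex_num_powr_antimono) simp_all
  moreover have "Bseq (\<lambda>n. ?a (n + r))"
  proof (rule BseqI')
    show "norm (?a (n + r)) \<le> ?a r" for n
      using ex_num_powr_antimono[of r "n + r"] by simp
  qed
  ultimately have "convergent (\<lambda>n. ?a (n + r))"
    by (intro Bseq_monoseq_convergent) (simp_all add: decseq_imp_monoseq)
  then have "convergent ?a" using convergent_ignore_initial_segment by blast
  then show ?thesis unfolding ex_density_def by (simp add: convergent_LIMSEQ_iff)
qed

lemma ex_density_powr_le_ex_num: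
  assumes "r \<le> n"
  shows "ex_density L H powr real (n choose r) \<le> real (ex_num L H n)"
proof -
  let ?a = "\<lambda>n. real (ex_num L H n) powr (1 / real (n choose r))"
  have "eventually (\<lambda>m. ?a m \<le> ?a n) sequentially"
    using eventually_ge_at_top[of n] by eventually_elim (rule ex_num_powr_antimono[OF assms])
  then have "ex_density L H \<le> ?a n"
    using ex_num_powr_tendsto by (intro tendsto_upperbound[OF ex_num_powr_tendsto]) auto
  moreover have "0 \<le> ex_density L H"
    by (rule tendsto_lowerbound[OF ex_num_powr_tendsto]) auto
  ultimately have "ex_density L H powr real (n choose r) \<le> ?a n powr real (n choose r)"
    by (intro powr_mono2) simp_all
  also have "\<dots> = real (ex_num L H n)"
    using assms by (simp add: powr_powr)
  finally show ?thesis .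
qed

section \<open>Templates without small obstructions\<close>

text \<open>Two \<open>r\<close>-sets that share the entries of an atom span between \<open>r + 1\<close> and \<open>2 * r - 1\<close> vertices,
  as arities are positive. If the types chosen on them disagreed on the atom, they would be jointly
  unsatisfiable, and their union would carry an error.\<close>

lemma choices_agree_if_no_error:
  assumes M: "is_struct (type_lang L H) M" "complete_pat L H M"
    and no_err: "\<And>Y. Y \<subseteq> univ M \<Longrightarrow> Y \<noteq> {} \<Longrightarrow> induced M Y \<notin> errors L H"
    and \<chi>: "choice_function L H M \<chi>" and AB: "A \<in> nsets (univ M) r" "B \<in> nsets (univ M) r"
    and ts: "R \<in> symbols L" "ts \<in> tuples (arity L R) (A \<inter> B)" "Rel R ts \<in> \<chi> A"
  shows "Rel R ts \<in> \<chi> B"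
proof (rule ccontr)
  assume not: "Rel R ts \<notin> \<chi> B"
  then have "A \<noteq> B" using ts(3) by blast
  have A: "A \<subseteq> univ M" "finite A" "card A = r" and B: "B \<subseteq> univ M" "finite B" "card B = r"
    using AB by (auto simp: nsets_def)
  have "length ts \<noteq> 0" using ts(1,2) arity_pos by (fastforce simp: tuples_def)
  then have "A \<inter> B \<noteq> {}" using ts(2) by (cases ts) (auto simp: tuples_def)
  then have "0 < card (A \<inter> B)" using A(2) by (simp add: card_gt_0_iff)
  then have lt: "card (A \<union> B) < 2 * r" using card_Un_Int[OF A(2) B(2)] A(3) B(3) by linarith
  have gt: "r < card (A \<union> B)"
  proof (rule ccontr)
    assume "\<not> r < card (A \<union> B)"
    then have "A = A \<union> B" "B = A \<union> B"
      using A B by (intro card_seteq; simp)+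
    then show False using \<open>A \<noteq> B\<close> by metis
  qed
  obtain p a where a: "p \<in> S_types L H" "a \<in> dtuples r (univ M)" "set a = A" "a \<in> interp M p" "\<chi> A = inst p a"
    using \<chi> AB(1) unfolding choice_function_iff Ch_def by blast
  obtain q b where b: "q \<in> S_types L H" "b \<in> dtuples r (univ M)" "set b = B" "b \<in> interp M q" "\<chi> B = inst q b"
    using \<chi> AB(2) unfolding choice_function_iff Ch_def by blast
  have wf: "wf_qf L (set b) (Rel R ts)" using ts(1,2) b(3) by (auto simp: tuples_def)
  have "Neg (Rel R ts) \<in> inst q b"
    using Neg_in_inst[OF b(1) _ _ wf] b(2,5) not by (simp add: dtuples_def tuples_def)
  then have unsat: "\<not> satisfiable L (inst p a \<union> inst q b)"
    using ts(3) a(5) unfolding satisfiable_def by (metis UnCI sat.simps(3))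
  let ?Y = "A \<union> B"
  have Y: "?Y \<subseteq> univ M" "finite ?Y" "?Y \<noteq> {}" using A B \<open>A \<inter> B \<noteq> {}\<close> by auto
  have "a \<in> dtuples r ?Y" "b \<in> dtuples r ?Y" "a \<in> interp (induced M ?Y) p" "b \<in> interp (induced M ?Y) q"
    using a(2-4) b(2-4) by (auto simp: dtuples_def tuples_def lists_eq_set)
  moreover have "is_fin_struct (type_lang L H) (induced M ?Y)" "complete_pat L H (induced M ?Y)"
    using is_struct_induced[OF M(1) Y(3)] Y(2) complete_pat_induced[OF M(2) Y(1)]
    by (simp_all add: is_fin_struct_def del: induced_simps(2))
  moreover have "univ (induced M ?Y) = set a \<union> set b" using a(3) b(3) by simp
  ultimately have "is_error L H (card ?Y) (induced M ?Y)"
    unfolding is_error_def using a(1) b(1) unsat by (metis induced_simps(1))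
  then have "induced M ?Y \<in> errors L H" unfolding errors_def using lt gt by blast
  then show False using no_err[OF Y(1,3)] by blast
qed

text \<open>Since no errors occur, the types selected by a choice function fit together to one structure
  \<open>N\<close>. If \<open>N\<close> had a substructure in \<open>F\<close>, on a set \<open>Y\<close> say, then that substructure would be a full
  subpattern of the pattern induced on \<open>Y\<close>, which would then lie in \<open>F_tilde L H F\<close>. This includes
  sets \<open>Y\<close> with fewer than \<open>r\<close> elements, where being a full subpattern only constrains the
  domain.\<close>

lemma H_random_if_no_obstruction:
  assumes M: "is_struct (type_lang L H) M" "complete_pat L H M" "finite (univ M)"
    and F: "iso_closed L F" "H = Forb L F"
    and no_obs: "\<And>Y. Y \<subseteq> univ M \<Longrightarrow> Y \<noteq> {} \<Longrightarrow> induced M Y \<notin> F_tilde L H F \<union> errors L H"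
  shows "H_random L H M"
  unfolding H_random_def
proof (intro conjI allI impI M(2))
  fix \<chi> assume \<chi>: "choice_function L H M \<chi>"
  \<comment> \<open>an atom holds in \<open>N\<close> if it is chosen on some \<open>r\<close>-set around it; by agreement, then on all\<close>
  define N where "N = \<lparr>univ = univ M, interp = (\<lambda>R. {ts. R \<in> symbols L \<and>
    (\<exists>A\<in>nsets (univ M) r. ts \<in> tuples (arity L R) A \<and> Rel R ts \<in> \<chi> A)})\<rparr>"
  have univ_N: "univ N = univ M" by (simp add: N_def)
  have struct_N: "is_struct L N"
    using M(1) unfolding is_struct_def N_def by (auto simp: tuples_def nsets_def)
  have agree: "Rel R ts \<in> \<chi> B"
    if "A \<in> nsets (univ M) r" "B \<in> nsets (univ M) r" "R \<in> symbols L"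
      "ts \<in> tuples (arity L R) (A \<inter> B)" "Rel R ts \<in> \<chi> A" for A B R ts
    using choices_agree_if_no_error[OF M(1,2) _ \<chi> that] no_obs by blast
  have Diag_N: "Diag L N A = \<chi> A" if A: "A \<in> nsets (univ M) r" for A
  proof -
    obtain p a where a: "p \<in> S_types L H" "a \<in> dtuples r (univ M)" "set a = A" "\<chi> A = inst p a"
      using \<chi> A unfolding choice_function_iff Ch_def by blast
    have "Diag L N (set a) = inst p a"
    proof (rule Diag_eq_inst[OF a(1)])
      show "length a = r" "distinct a" using a(2) by (simp_all add: dtuples_def tuples_def)
      fix R ts assume ts: "R \<in> symbols L" "ts \<in> tuples (arity L R) (set a)"
      show "ts \<in> interp N R \<longleftrightarrow> Rel R ts \<in> inst p a"
      proof
        assume "ts \<in> interp N R"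
        then obtain B where B: "B \<in> nsets (univ M) r" "ts \<in> tuples (arity L R) B" "Rel R ts \<in> \<chi> B"
          unfolding N_def by auto
        have "ts \<in> tuples (arity L R) (B \<inter> A)" using B(2) ts(2) a(3) by (auto simp: tuples_def)
        then show "Rel R ts \<in> inst p a" using agree[OF B(1) A ts(1) _ B(3)] a(4) by simp
      next
        assume "Rel R ts \<in> inst p a"
        then have "ts \<in> tuples (arity L R) A" "Rel R ts \<in> \<chi> A" using ts(2) a(3,4) by simp_all
        then show "ts \<in> interp N R" using A ts(1) unfolding N_def by auto
      qed
    qed
    then show ?thesis using a(3,4) by simp
  qed
  have "\<not> (\<exists>N'. substructure N' N \<and> (\<exists>B\<in>F. isomorphic N' B))"
  proof
    assume "\<exists>N'. substructure N' N \<and> (\<exists>B\<in>F. isomorphic N' B)"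
    then obtain Y B where Y: "Y \<noteq> {}" "Y \<subseteq> univ M" and B: "B \<in> F" "isomorphic (induced N Y) B"
      unfolding substructure_iff_induced univ_N by blast
    have NY: "is_struct L (induced N Y)" using struct_N Y(1) by (rule is_struct_induced)
    have in_F: "induced N Y \<in> F"
      using F(1) B(1) NY isomorphic_sym[OF B(2)] unfolding iso_closed_def by blast
    have "Diag L (induced N Y) A \<in> Ch L H (induced M Y) A" if "A \<in> nsets Y r" for A
    proof -
      have A: "A \<subseteq> Y" "A \<in> nsets (univ M) r" using that Y(2) by (auto simp: nsets_def)
      then have "\<chi> A \<in> Ch L H M A" using \<chi> unfolding choice_function_iff by blast
      then show ?thesis
        unfolding Diag_induced[OF A(1)] Ch_induced[OF A(1) Y(2)] Diag_N[OF A(2)] .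
    qed
    then have "full_subpattern L H (induced N Y) (induced M Y)"
      unfolding full_subpattern_iff using NY by simp
    then have "induced M Y \<in> F_tilde L H F"
      unfolding F_tilde_def
      using is_struct_induced[OF M(1) Y(1)] complete_pat_induced[OF M(2) Y(2)] in_F by blast
    then show False using no_obs[OF Y(2,1)] by blast
  qed
  then have "N \<in> Forb L F"
    unfolding Forb_def is_fin_struct_def using struct_N M(3) univ_N by simp
  then have "N \<in> H" using F(2) by blast
  moreover have "chosen_subpattern L N \<chi> M"
    unfolding chosen_subpattern_def using struct_N univ_N Diag_N by blast
  ultimately show "\<exists>N\<in>H. chosen_subpattern L N \<chi> M" by blast
qed

section \<open>Supersaturation\<close>

text \<open>The size \<open>K\<close> is chosen such that the density of random templates of size \<open>K\<close> is already below
  \<open>exp \<beta>\<close>, and \<open>\<epsilon>\<close> such that the \<open>K\<close>-sets with an obstruction contribute at most \<open>\<gamma>\<close> to the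
  average.\<close>

theorem sub_le_if_few_obstructions:
  assumes F: "iso_closed L F" "H = Forb L F"
    and \<beta>: "0 \<le> \<beta>" "ex_density L H < exp \<beta>" and \<gamma>: "0 < \<gamma>"
  shows "\<exists>\<epsilon>>0. \<exists>K. \<forall>n M. K \<le> n \<and> r \<le> n \<and> template L H M \<and> finite (univ M) \<and> size_of M = n \<and>
    prob_class (up_to_size (F_tilde L H F \<union> errors L H) K) M < \<epsilon> \<longrightarrow>
    real (sub L H M) \<le> exp ((\<beta> + \<gamma>) * real (n choose r))"
proof -
  let ?\<Lambda> = "ln (1 + real max_choices)" and ?C = "F_tilde L H F \<union> errors L H"
  have "eventually (\<lambda>n. real (ex_num L H n) powr (1 / real (n choose r)) < exp \<beta>) sequentially"
    using ex_num_powr_tendsto \<beta>(2) by (rule order_tendstoD(2))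
  then have "eventually (\<lambda>n. real (ex_num L H n) powr (1 / real (n choose r)) < exp \<beta> \<and> r \<le> n) sequentially"
    using eventually_ge_at_top[of r] by eventually_elim simp
  then obtain K where K: "real (ex_num L H K) powr (1 / real (K choose r)) < exp \<beta>" "r \<le> K"
    using eventually_happens'[OF sequentially_bot] by blast
  let ?T = "real (num_codes (type_lang L H) K) * 2 ^ K"
  \<comment> \<open>\<open>\<eta>\<close> is the admissible fraction of bad sets, each of which costs at most \<open>?\<Lambda>\<close>; the summands
    \<open>1\<close> only keep the denominators positive\<close>
  define \<eta> where "\<eta> = \<gamma> / (1 + ?\<Lambda>)"
  define \<epsilon> where "\<epsilon> = \<eta> / (1 + ?T)"
  have \<Lambda>: "0 \<le> ?\<Lambda>" by simp
  have T: "0 \<le> ?T" by simp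
  have \<eta>: "0 < \<eta>" "\<eta> * ?\<Lambda> \<le> \<gamma>"
    using \<gamma> \<Lambda> by (simp_all add: \<eta>_def field_simps add_pos_nonneg)
  have \<epsilon>: "0 < \<epsilon>" "?T * \<epsilon> \<le> \<eta>"
    using \<eta>(1) T by (simp_all add: \<epsilon>_def field_simps add_pos_nonneg)
  show ?thesis
  proof (intro exI[of _ \<epsilon>] conjI \<epsilon>(1) exI[of _ K] allI impI)
    fix n M
    assume "K \<le> n \<and> r \<le> n \<and> template L H M \<and> finite (univ M) \<and> size_of M = n \<and>
      prob_class (up_to_size ?C K) M < \<epsilon>"
    then have n: "K \<le> n" "r \<le> n" and M: "template L H M" "finite (univ M)" "size_of M = n"
      and pc: "prob_class (up_to_size ?C K) M < \<epsilon>" by blast+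
    have str: "is_struct (type_lang L H) M" and complete: "complete_pat L H M"
      using M(1) by (simp_all add: template_def Let_def)
    define B where "B = {X \<in> nsets (univ M) K. \<exists>Y\<subseteq>X. Y \<noteq> {} \<and> induced M Y \<in> ?C}"
    have "real (card B) \<le> ?T * \<epsilon> * real (size_of M choose K)"
      unfolding B_def
      using card_sets_containing_class[OF str M(2) finite_type_lang pc] n(1) M(3) \<epsilon>(1) by simp
    also have "\<dots> \<le> \<eta> * real (size_of M choose K)"
      using \<epsilon>(2) by (rule mult_right_mono) simp
    finally have cB: "real (card B) \<le> \<eta> * real (size_of M choose K)" .
    have good: "log_choices (induced M X) \<le> \<beta> * real (K choose r)"
      if X: "X \<in> nsets (univ M) K" "X \<notin> B" for X
    proof -
      have X': "X \<subseteq> univ M" "finite X" "card X = K" using X(1) by (auto simp: nsets_def)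
      then have "X \<noteq> {}" using r_pos K(2) by auto
      note ind = template_induced[OF M(1) X'(1) this] is_struct_induced[OF str this]
        complete_pat_induced[OF complete X'(1)]
      have "induced (induced M X) Y \<notin> ?C" if "Y \<subseteq> univ (induced M X)" "Y \<noteq> {}" for Y
        using X that unfolding B_def by (auto simp: induced_induced)
      then have "H_random L H (induced M X)"
        using X' by (intro H_random_if_no_obstruction[OF ind(2,3) _ F]) simp_all
      then have "induced M X \<in> random_templates L H K"
        using ind(1) X' by (simp add: random_templates_def)
      then have ex: "0 < ex_num L H K" "log_choices (induced M X) \<le> ln (real (ex_num L H K))"
        using log_choices_le_ln_ex_num K(2) by blast+
      have "ln (real (ex_num L H K)) / real (K choose r) < \<beta>"
        using K(1) ex(1) by (simp add: powr_def)
      then have "ln (real (ex_num L H K)) \<le> \<beta> * real (K choose r)"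
        using K(2) by (simp add: divide_less_eq split: if_splits)
      then show ?thesis using ex(2) by linarith
    qed
    have "log_choices M \<le> (\<beta> + \<eta> * ?\<Lambda>) * real (size_of M choose r)"
      using K(2) n(1) M(3) \<beta>(1) cB
      by (intro log_choices_averaging[OF complete M(2), where B = B and K = K] good) (auto simp: B_def)
    also have "\<dots> \<le> (\<beta> + \<gamma>) * real (n choose r)"
      using \<eta>(2) M(3) by (simp add: mult_right_mono)
    finally have "exp (log_choices M) \<le> exp ((\<beta> + \<gamma>) * real (n choose r))" by simp
    moreover have "real (sub L H M) \<le> exp (log_choices M)"
      using sub_le_exp_log_choices[OF M(2) _ complete] M(3) n(2) by blast
    ultimately show "real (sub L H M) \<le> exp ((\<beta> + \<gamma>) * real (n choose r))" by linarith
  qed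
qed

end

theorem theorem7:
  fixes L :: "'s lang" and r :: nat and H F :: "('s, 'v) rel_struct set"
  assumes "infinite (UNIV :: 'v set)"
    and "finite_lang L" and "max_arity L = r" and "2 \<le> r"
    and "hereditary_property L H" and "\<not> trivial_property H"
    and "\<forall>A\<in>F. is_fin_struct L A" and "iso_closed L F"
    and "H = Forb L F"
  shows "\<forall>\<delta>>0. \<exists>\<epsilon>>0. \<exists>K. \<forall>\<^sub>F n in sequentially. \<forall>M :: ('s, 'v) pat.
    template L H M \<and> finite (univ M) \<and> size_of M = n \<and>
    prob_class (up_to_size (F_tilde L H F) K \<union> up_to_size (errors L H) K) M < (\<epsilon> :: real) \<longrightarrow>
      (ex_density L H > 1 \<longrightarrow> real (sub L H M) \<le> real (ex_num L H n) powr (1 + \<delta>)) \<and>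
      (ex_density L H \<le> 1 \<longrightarrow> real (sub L H M) \<le> 2 powr (\<delta> * real (n choose r)))"
proof (intro allI impI)
  fix \<delta> :: real assume \<delta>: "0 < \<delta>"
  interpret hereditary_lang_property L H
    using assms(2,5) by unfold_locales
  have up: "up_to_size (F_tilde L H F) K \<union> up_to_size (errors L H) K
      = up_to_size (F_tilde L H F \<union> errors L H) K" for K
    by (auto simp: up_to_size_def)
  let ?\<pi> = "ex_density L H"
  \<comment> \<open>Both \<open>\<beta>\<close> and \<open>\<gamma>\<close> take half of the slack allowed by \<open>\<delta>\<close>, which is measured in units of
    \<open>ln ?\<pi>\<close> in the first case because \<open>ex_num L H n\<close> is at least \<open>?\<pi> powr (n choose r)\<close>.\<close>
  define \<beta> where "\<beta> = (if ?\<pi> > 1 then (1 + \<delta> / 2) * ln ?\<pi> else \<delta> / 2 * ln 2)"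
  define \<gamma> where "\<gamma> = (if ?\<pi> > 1 then \<delta> / 2 * ln ?\<pi> else \<delta> / 2 * ln 2)"
  have \<gamma>: "0 < \<gamma>" using \<delta> by (simp add: \<gamma>_def)
  have \<beta>0: "0 \<le> \<beta>" using \<delta> by (simp add: \<beta>_def)
  have \<beta>1: "?\<pi> < exp \<beta>"
  proof (cases "?\<pi> > 1")
    case True
    then have "ln ?\<pi> < \<beta>" using \<delta> by (simp add: \<beta>_def)
    then have "exp (ln ?\<pi>) < exp \<beta>" by (simp only: exp_less_cancel_iff)
    then show ?thesis using True by simp
  next
    case False
    then have "0 < \<beta>" using \<delta> by (simp add: \<beta>_def)
    then have "1 < exp \<beta>" by simp
    then show ?thesis using False by linarith
  qed
  obtain \<epsilon> K where \<epsilon>: "0 < \<epsilon>" and sub_le: "\<forall>n M. K \<le> n \<and> max_arity L \<le> n \<and> template L H M \<and>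
    finite (univ M) \<and> size_of M = n \<and>
    prob_class (up_to_size (F_tilde L H F \<union> errors L H) K) M < \<epsilon> \<longrightarrow>
    real (sub L H M) \<le> exp ((\<beta> + \<gamma>) * real (n choose max_arity L))"
    using sub_le_if_few_obstructions[OF assms(8,9) \<beta>0 \<beta>1 \<gamma>] by blast
  have "(?\<pi> > 1 \<longrightarrow> real (sub L H M) \<le> real (ex_num L H n) powr (1 + \<delta>)) \<and>
      (?\<pi> \<le> 1 \<longrightarrow> real (sub L H M) \<le> 2 powr (\<delta> * real (n choose r)))"
    if n: "K \<le> n" "r \<le> n" and M: "template L H M \<and> finite (univ M) \<and> size_of M = n \<and>
      prob_class (up_to_size (F_tilde L H F) K \<union> up_to_size (errors L H) K) M < \<epsilon>" for n M
  proof -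
    have le: "real (sub L H M) \<le> exp ((\<beta> + \<gamma>) * real (n choose r))"
      using sub_le n M unfolding up assms(3) by blast
    show ?thesis
    proof (intro conjI impI)
      assume gt: "?\<pi> > 1"
      then have "\<beta> + \<gamma> = (1 + \<delta>) * ln ?\<pi>" by (simp add: \<beta>_def \<gamma>_def algebra_simps)
      then have "exp ((\<beta> + \<gamma>) * real (n choose r)) = (?\<pi> powr real (n choose r)) powr (1 + \<delta>)"
        using gt by (simp add: powr_powr powr_def mult_ac)
      also have "\<dots> \<le> real (ex_num L H n) powr (1 + \<delta>)"
        using ex_density_powr_le_ex_num[of n] n(2) \<delta> unfolding assms(3) by (intro powr_mono2) simp_all
      finally show "real (sub L H M) \<le> real (ex_num L H n) powr (1 + \<delta>)" using le by linarith
    next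
      assume "?\<pi> \<le> 1"
      then have "\<beta> + \<gamma> = \<delta> * ln 2" by (simp add: \<beta>_def \<gamma>_def)
      then have "exp ((\<beta> + \<gamma>) * real (n choose r)) = 2 powr (\<delta> * real (n choose r))"
        by (simp add: powr_def mult_ac)
      then show "real (sub L H M) \<le> 2 powr (\<delta> * real (n choose r))" using le by simp
    qed
  qed
  then have "\<forall>\<^sub>F n in sequentially. \<forall>M :: ('s, 'v) pat.
    template L H M \<and> finite (univ M) \<and> size_of M = n \<and>
    prob_class (up_to_size (F_tilde L H F) K \<union> up_to_size (errors L H) K) M < \<epsilon> \<longrightarrow>
      (?\<pi> > 1 \<longrightarrow> real (sub L H M) \<le> real (ex_num L H n) powr (1 + \<delta>)) \<and>
      (?\<pi> \<le> 1 \<longrightarrow> real (sub L H M) \<le> 2 powr (\<delta> * real (n choose r)))"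
    using eventually_ge_at_top[of "max K r"] by (auto elim!: eventually_mono)
  then show "\<exists>\<epsilon>>0. \<exists>K. \<forall>\<^sub>F n in sequentially. \<forall>M :: ('s, 'v) pat.
    template L H M \<and> finite (univ M) \<and> size_of M = n \<and>
    prob_class (up_to_size (F_tilde L H F) K \<union> up_to_size (errors L H) K) M < \<epsilon> \<longrightarrow>
      (?\<pi> > 1 \<longrightarrow> real (sub L H M) \<le> real (ex_num L H n) powr (1 + \<delta>)) \<and>
      (?\<pi> \<le> 1 \<longrightarrow> real (sub L H M) \<le> 2 powr (\<delta> * real (n choose r)))"
    using \<epsilon> by blast
qed

end
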